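(* Let $f:\mathbb{R}\to\mathbb{R}$ be convex with $f(0)=0$ being the minimum of $f$. Let $u_0\in\mathcal{B}$, put $M=\|u_0\|_{L^\infty(\mathbb{R})}$, and assume that for some constant $C$ $$\|a\|_{L^\infty([0,M])}\leq C,\qquad a(v):=\frac{f'(v)v-f(v)}{v^2}.$$ Assume furthermore that $u_0$ is $\mathrm{Lip}^+$ bounded and that $\mathrm{supp}(u_0)$ consists of one connected component. Then the support of the entropy solution $u(t)$ of $u_t+f(u)_x=0$, $u(x,0)=u_0(x)$, is connected for any $t>0$.
   Context: $\mathcal{B}:=\{u\in L^\infty(\mathbb{R}): u\geq0,\ \mathrm{supp}(u)\text{ compact},\ \int_{\mathbb{R}}u\,dx=1\}$. A function $v$ is $\mathrm{Lip}^+$ bounded if there is a constant $K$ with $\frac{v(x+z)-v(x)}{z}\leq K$ for all $x,z\in\mathbb{R}$, $z\neq0$. The derivative $f'$ of the convex function $f$ exists almost everywhere. *)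

theory Defs
  imports "HOL-Probability.Essential_Supremum"
begin

text \<open>Elements of \<open>L\<^sup>\<infinity>(\<real>)\<close> are represented by Borel functions. Only
  \<open>Lip_plus_bounded\<close> depends on the choice of the representative.\<close>

definition Linf_norm :: "'a measure \<Rightarrow> ('a \<Rightarrow> real) \<Rightarrow> ereal" where
  "Linf_norm M v = esssup M (\<lambda>x. ereal \<bar>v x\<bar>)"

text \<open>The support of a class of functions: the complement of the largest open set on which
  the function vanishes almost everywhere.\<close>

definition ess_support :: "(real \<Rightarrow> real) \<Rightarrow> real set" where
  "ess_support v = - \<Union>{U. open U \<and> (AE x in lborel. x \<in> U \<longrightarrow> v x = 0)}"

definition class_B :: "(real \<Rightarrow> real) set" where
  "class_B = {v. v \<in> borel_measurable lborel \<and> Linf_norm lborel v < \<infinity> \<and>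
     (AE x in lborel. 0 \<le> v x) \<and> compact (ess_support v) \<and>
     integrable lborel v \<and> (LINT x|lborel. v x) = 1}"

definition Lip_plus_bounded :: "(real \<Rightarrow> real) \<Rightarrow> bool" where
  "Lip_plus_bounded v \<longleftrightarrow> (\<exists>K. \<forall>x z. z \<noteq> 0 \<longrightarrow> (v (x + z) - v x) / z \<le> K)"

text \<open>For convex \<open>f\<close>, \<open>deriv f\<close> is the derivative outside a countable set and has an
  unspecified value on that set, so \<open>a_coeff f\<close> is only meaningful almost everywhere.\<close>

definition a_coeff :: "(real \<Rightarrow> real) \<Rightarrow> real \<Rightarrow> real" where
  "a_coeff f v = (deriv f v * v - f v) / v\<^sup>2"

text \<open>Nonnegative \<open>C\<^sup>1\<close> test functions of \<open>(t, x)\<close> with compact support in \<open>t > 0\<close>,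
  given together with their partial derivatives \<open>\<phi>t\<close> and \<open>\<phi>x\<close>.\<close>

definition test_function ::
  "(real \<times> real \<Rightarrow> real) \<Rightarrow> (real \<times> real \<Rightarrow> real) \<Rightarrow> (real \<times> real \<Rightarrow> real) \<Rightarrow> bool" where
  "test_function \<phi> \<phi>t \<phi>x \<longleftrightarrow>
     (\<forall>p. (\<phi> has_derivative (\<lambda>h. \<phi>t p * fst h + \<phi>x p * snd h)) (at p)) \<and>
     continuous_on UNIV \<phi>t \<and> continuous_on UNIV \<phi>x \<and>
     (\<forall>p. 0 \<le> \<phi> p) \<and>
     (\<exists>K. compact K \<and> K \<subseteq> {0<..} \<times> UNIV \<and> (\<forall>p. p \<notin> K \<longrightarrow> \<phi> p = 0))"

text \<open>Kruzhkov entropy solutions: bounded measurable functions of \<open>(t, x)\<close>, continuous as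
  maps from \<open>[0, \<infinity>)\<close> to \<open>L\<^sup>1\<^sub>l\<^sub>o\<^sub>c\<close> (so that \<open>u t\<close> is a well-defined class for every \<open>t\<close>
  and the initial condition makes sense), which satisfy in the distributional sense
  \<open>\<partial>\<^sub>t \<bar>u - k\<bar> + \<partial>\<^sub>x (sgn (u - k) (f u - f k)) \<le> 0\<close> for all constants \<open>k\<close>.
  The values of \<open>u t\<close> for \<open>t < 0\<close> are irrelevant.\<close>

definition entropy_solution ::
  "(real \<Rightarrow> real) \<Rightarrow> (real \<Rightarrow> real) \<Rightarrow> (real \<Rightarrow> real \<Rightarrow> real) \<Rightarrow> bool" where
  "entropy_solution f u0 u \<longleftrightarrow>
     set_borel_measurable lborel ({0..} \<times> UNIV) (\<lambda>(t, x). u t x) \<and>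
     (\<exists>B. \<forall>t\<ge>0. AE x in lborel. \<bar>u t x\<bar> \<le> B) \<and>
     (\<forall>t\<ge>0. \<forall>r. ((\<lambda>s. LINT x:{-r..r}|lborel. \<bar>u s x - u t x\<bar>) \<longlongrightarrow> 0) (at t within {0..})) \<and>
     (AE x in lborel. u 0 x = u0 x) \<and>
     (\<forall>k \<phi> \<phi>t \<phi>x. test_function \<phi> \<phi>t \<phi>x \<longrightarrow>
        0 \<le> (LINT (t, x):({0<..} \<times> UNIV)|lborel.
               \<bar>u t x - k\<bar> * \<phi>t (t, x) + sgn (u t x - k) * (f (u t x) - f k) * \<phi>x (t, x)))"

end

theory Submission imports Defs begin

text \<open>Let \<open>c\<close> be the infimum of \<open>f k / k\<close> over \<open>k > 0\<close>, the speed at which a vacuum is transported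
  by nonnegative solutions. Suppose that \<open>u T\<close> vanishes on an interval \<open>(a + c T, b + c T)\<close>, and
  test the entropy inequality for \<open>(k - u)\<^sub>+\<close>, which attains its maximum \<open>k\<close> on this gap,
  with cutoffs moving at speed \<open>c\<close>. The flux relative to this motion lies between \<open>0\<close> and
  \<open>f k - c k\<close>, so up to a constant \<open>\<integral> min u k\<close> over the shifted gap at an earlier time \<open>s\<close> is
  at most \<open>(T - s) (f k - c k)\<close>. Dividing by \<open>k\<close> and letting \<open>f k / k\<close> tend to \<open>c\<close> shows that
  \<open>u s\<close> vanishes on \<open>(a + c s, b + c s)\<close>: gaps persist backwards in time.

  In particular the initial datum, whose support is connected, vanishes on one whole side of the
  gap \<open>(a, b)\<close>. Mass never moves more slowly than \<open>c\<close>, so a vacuum to the left of the gap stays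
  there; and no mass crosses the moving gap, so a vacuum to its right stays there as well.
  Hence the support of \<open>u T\<close> does not have points on both sides of the gap.\<close>

section \<open>A continuously differentiable step function\<close>

lemma DERIV_pos_part_squared:
  "((\<lambda>x::real. (max 0 x)\<^sup>2) has_real_derivative 2 * max 0 x) (at x)"
proof (cases "x = 0")
  case True
  have "((\<lambda>h::real. (max 0 h)\<^sup>2 / h) \<longlongrightarrow> 0) (at 0)"
  proof (rule Lim_null_comparison)
    show "\<forall>\<^sub>F h::real in at 0. norm ((max 0 h)\<^sup>2 / h) \<le> \<bar>h\<bar>"
      by (intro always_eventually allI) (auto simp: max_def power2_eq_square)
    show "((\<lambda>h::real. \<bar>h\<bar>) \<longlongrightarrow> 0) (at 0)"
      by (auto intro!: tendsto_eq_intros)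
  qed
  with True show ?thesis by (simp add: DERIV_def)
next
  case False
  show ?thesis
  proof (cases "x > 0")
    case True
    have "((\<lambda>x::real. x\<^sup>2) has_real_derivative 2 * max 0 x) (at x)"
      using True by (auto intro!: derivative_eq_intros)
    then show ?thesis
      by (rule has_field_derivative_transform_within_open[where S="{0<..}"])
         (use True in auto)
  next
    case x: False
    have "((\<lambda>x::real. 0) has_real_derivative 2 * max 0 x) (at x)"
      using x by auto
    then show ?thesis
      by (rule has_field_derivative_transform_within_open[where S="{..<0}"])
         (use x False in auto)
  qed
qed

text \<open>A quadratic spline with knots 0, 1/2 and 1: it is 2 x^2 on [0, 1/2], then 1 - 2 (1 -
  x)^2 up to 1, and constant outside [0, 1]. Test functions only have to be C^1, which a spline
  satisfies with elementary computations. Its derivative is the tent of height 2 on [0, 1], of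
  integral 1.\<close>

definition smoothstep :: "real \<Rightarrow> real" where
  "smoothstep x = 2 * ((max 0 x)\<^sup>2 - 2 * (max 0 (x - 1/2))\<^sup>2 + (max 0 (x - 1))\<^sup>2)"

definition smoothstep_deriv :: "real \<Rightarrow> real" where
  "smoothstep_deriv x = 4 * (max 0 x - 2 * max 0 (x - 1/2) + max 0 (x - 1))"

lemma DERIV_smoothstep [derivative_intros]:
  assumes "(g has_real_derivative g') (at x within A)"
  shows "((\<lambda>x. smoothstep (g x)) has_real_derivative smoothstep_deriv (g x) * g') (at x within A)"
proof -
  have sh: "((\<lambda>x::real. (max 0 (x - c))\<^sup>2) has_real_derivative 2 * max 0 (y - c)) (at y)" for c y
    using DERIV_shift[of "\<lambda>x. (max 0 x)\<^sup>2" "2 * max 0 (y - c)" y "- c"]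
      DERIV_pos_part_squared[of "y - c"] by simp
  have "(smoothstep has_real_derivative 2 * (2 * max 0 y - 2 * (2 * max 0 (y - 1/2))
      + 2 * max 0 (y - 1))) (at y)" for y
    unfolding smoothstep_def
    by (intro DERIV_cmult DERIV_add DERIV_diff DERIV_pos_part_squared sh)
  then have "(smoothstep has_real_derivative smoothstep_deriv y) (at y)" for y
    by (simp add: smoothstep_deriv_def)
  from DERIV_chain2[OF this assms] show ?thesis .
qed

lemma continuous_on_smoothstep_deriv [continuous_intros]:
  "continuous_on A g \<Longrightarrow> continuous_on A (\<lambda>x. smoothstep_deriv (g x))"
  unfolding smoothstep_deriv_def by (intro continuous_intros)

lemma continuous_on_smoothstep [continuous_intros]:
  "continuous_on A g \<Longrightarrow> continuous_on A (\<lambda>x. smoothstep (g x))"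
  unfolding smoothstep_def by (intro continuous_intros)

lemma smoothstep_deriv_nonneg: "0 \<le> smoothstep_deriv x"
  unfolding smoothstep_deriv_def by (auto simp: max_def)

lemma smoothstep_deriv_eq_0: "x \<le> 0 \<or> 1 \<le> x \<Longrightarrow> smoothstep_deriv x = 0"
  unfolding smoothstep_deriv_def by (auto simp: max_def)

lemma smoothstep_mono: "x \<le> y \<Longrightarrow> smoothstep x \<le> smoothstep y"
  by (rule DERIV_nonneg_imp_nondecreasing)
     (auto intro!: exI derivative_eq_intros smoothstep_deriv_nonneg)

lemma smoothstep_eq_0: "x \<le> 0 \<Longrightarrow> smoothstep x = 0"
  unfolding smoothstep_def by auto

lemma smoothstep_eq_1: "1 \<le> x \<Longrightarrow> smoothstep x = 1"
  unfolding smoothstep_def by (auto simp: max_def power2_eq_square algebra_simps)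

text \<open>On [0, 1/2] the spline is 2 x^2, and monotonicity does the rest. Strict positivity is
  what later turns a vanishing integral against a product of cutoffs into vanishing almost
  everywhere between the edges.\<close>

lemma smoothstep_pos: "0 < x \<Longrightarrow> 0 < smoothstep x"
proof -
  assume "0 < x"
  then have "0 < 2 * (min x (1/2))\<^sup>2" by simp
  also have "\<dots> = smoothstep (min x (1/2))"
    using \<open>0 < x\<close> by (simp add: smoothstep_def)
  also have "\<dots> \<le> smoothstep x" by (rule smoothstep_mono) auto
  finally show ?thesis .
qed

lemma smoothstep_nonneg: "0 \<le> smoothstep x"
  using smoothstep_eq_0[of x] smoothstep_pos[of x] by (cases "x \<le> 0") auto

lemma smoothstep_le_1: "smoothstep x \<le> 1"
  using smoothstep_mono[of x "max 1 x"] by (simp add: smoothstep_eq_1)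

section \<open>Integrals of compactly supported functions and weak monotonicity\<close>

lemma integrable_bounded_vanishing:
  fixes h :: "'a::euclidean_space \<Rightarrow> real"
  assumes "h \<in> borel_measurable borel" and "compact K"
    and "\<And>x. x \<notin> K \<Longrightarrow> h x = 0" and "\<And>x. x \<in> K \<Longrightarrow> \<bar>h x\<bar> \<le> c"
  shows "integrable lborel h"
proof (rule Bochner_Integration.integrable_bound)
  show "integrable lborel (\<lambda>x. c * indicator K x :: real)"
    using emeasure_compact_finite[OF assms(2)] borel_compact[OF assms(2)]
    by (intro integrable_mult_right integrable_real_indicator) auto
  show "AE x in lborel. norm (h x) \<le> norm (c * indicator K x :: real)"
    using assms(3,4) by (intro AE_I2) (force simp: indicator_def)
qed (use assms(1) in auto)

lemma integral_deriv_vanishing: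
  fixes g g' :: "real \<Rightarrow> real"
  assumes "\<And>x. (g has_real_derivative g' x) (at x)" and "continuous_on UNIV g'"
    and "a \<le> b" and "\<And>x. x \<notin> {a..b} \<Longrightarrow> g' x = 0"
  shows "integrable lborel g'" and "(LINT x|lborel. g' x) = g b - g a"
proof -
  have eq: "g' = (\<lambda>x. g' x * indicator {a..b} x)"
    using assms(4) by (auto simp: indicator_def fun_eq_iff)
  have "has_bochner_integral lborel (\<lambda>x. g' x * indicator {a..b} x) (g b - g a)"
    by (rule has_bochner_integral_FTC_Icc_real)
       (use assms continuous_on_eq_continuous_at[of UNIV g'] in auto)
  then show "integrable lborel g'" "(LINT x|lborel. g' x) = g b - g a"
    using eq by (auto simp: has_bochner_integral_iff)
qed

text \<open>A ramp of width \<delta> rises from 0 to 1, so its derivative is a probability density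
  on [a, a + \<delta>]. It localises integrals near an endpoint in time and near a moving edge in
  space.\<close>

lemma integral_smoothstep_deriv:
  fixes a \<delta> :: real
  assumes "\<delta> > 0"
  shows "integrable lborel (\<lambda>x. smoothstep_deriv ((x - a) / \<delta>) / \<delta>)"
    and "(LINT x|lborel. smoothstep_deriv ((x - a) / \<delta>) / \<delta>) = 1"
proof -
  have 1: "((\<lambda>x. smoothstep ((x - a) / \<delta>)) has_real_derivative
      smoothstep_deriv ((x - a) / \<delta>) / \<delta>) (at x)" for x
    using assms by (auto intro!: derivative_eq_intros)
  have 2: "continuous_on UNIV (\<lambda>x. smoothstep_deriv ((x - a) / \<delta>) / \<delta>)"
    using assms by (intro continuous_intros) auto
  have 3: "smoothstep_deriv ((x - a) / \<delta>) / \<delta> = 0" if "x \<notin> {a..a+\<delta>}" for x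
    using that assms by (subst smoothstep_deriv_eq_0) (auto simp: field_simps)
  have 4: "a \<le> a + \<delta>" using assms by simp
  note I = integral_deriv_vanishing[OF 1 2 4 3]
  show "integrable lborel (\<lambda>x. smoothstep_deriv ((x - a) / \<delta>) / \<delta>)" by (rule I(1))
  show "(LINT x|lborel. smoothstep_deriv ((x - a) / \<delta>) / \<delta>) = 1"
    using I(2) assms by (simp add: smoothstep_eq_0 smoothstep_eq_1)
qed

text \<open>The hypothesis \<open>weak\<close> says that H' <= 0 in the sense of distributions on
  the open interval. Testing with a plateau that rises just after \<open>s\<close> and falls just
  before \<open>T\<close> compares a local average of \<open>H\<close> near \<open>s\<close> with
  one near \<open>T\<close>; continuity up to the endpoints identifies these averages with the end
  values up to a small error.\<close>

lemma nonincreasing_endpoints_of_weak_derivative: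
  fixes H :: "real \<Rightarrow> real"
  assumes "s < T" and contH: "continuous_on {s..T} H"
    and weak: "\<And>\<rho> \<rho>' a b. \<lbrakk>\<And>x. (\<rho> has_real_derivative \<rho>' x) (at x); continuous_on UNIV \<rho>';
        \<And>x. 0 \<le> \<rho> x; s < a; a < b; b < T; \<And>x. x \<notin> {a..b} \<Longrightarrow> \<rho> x = 0 \<and> \<rho>' x = 0\<rbrakk>
      \<Longrightarrow> 0 \<le> (LINT x|lborel. \<rho>' x * H x)"
  shows "H T \<le> H s"
proof (rule ccontr)
  assume "\<not> H T \<le> H s"
  \<comment> \<open>With an error of at most \<open>m\<close> at each end, a third of the supposed
    increase still leaves (H s + m) - (H T - m) = - m < 0.\<close>
  define m where "m = (H T - H s) / 3"
  have m: "m > 0" using \<open>\<not> H T \<le> H s\<close> by (simp add: m_def)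
  obtain d1 where d1: "d1 > 0" "\<And>x. x \<in> {s..T} \<Longrightarrow> \<bar>x - s\<bar> < d1 \<Longrightarrow> \<bar>H x - H s\<bar> < m"
    using contH m \<open>s < T\<close> unfolding continuous_on_iff dist_real_def
    by (meson atLeastAtMost_iff less_imp_le order_refl)
  obtain d2 where d2: "d2 > 0" "\<And>x. x \<in> {s..T} \<Longrightarrow> \<bar>x - T\<bar> < d2 \<Longrightarrow> \<bar>H x - H T\<bar> < m"
    using contH m \<open>s < T\<close> unfolding continuous_on_iff dist_real_def
    by (meson atLeastAtMost_iff less_imp_le order_refl)
  \<comment> \<open>The ramps will occupy [s + \<delta>, s + 2 \<delta>] and
    [T - 2 \<delta>, T - \<delta>]. Dividing by 5 keeps them disjoint, inside the open interval, and
    within \<open>d1\<close> and \<open>d2\<close> of the endpoints.\<close>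
  define \<delta> where "\<delta> = min (min d1 d2) (T - s) / 5"
  have \<delta>: "\<delta> > 0" "5 * \<delta> \<le> d1" "5 * \<delta> \<le> d2" "5 * \<delta> \<le> T - s"
    using d1(1) d2(1) \<open>s < T\<close> by (auto simp: \<delta>_def)
  define \<beta> where "\<beta> c x = smoothstep_deriv ((x - c) / \<delta>) / \<delta>" for c x
  define \<rho> where "\<rho> x = smoothstep ((x - (s + \<delta>)) / \<delta>) - smoothstep ((x - (T - 2 * \<delta>)) / \<delta>)" for x
  define \<rho>' where "\<rho>' x = \<beta> (s + \<delta>) x - \<beta> (T - 2 * \<delta>) x" for x
  have \<beta>0: "\<beta> c x = 0" if "x \<notin> {c..c + \<delta>}" for c x
    unfolding \<beta>_def using that \<delta>(1) by (subst smoothstep_deriv_eq_0) (auto simp: field_simps)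
  have \<beta>pos: "0 \<le> \<beta> c x" for c x
    using \<delta>(1) smoothstep_deriv_nonneg by (simp add: \<beta>_def)
  have I\<beta>: "integrable lborel (\<beta> c)" "(LINT x|lborel. \<beta> c x) = 1" for c
    using integral_smoothstep_deriv[OF \<delta>(1), of c] unfolding \<beta>_def by auto
  have "0 \<le> (LINT x|lborel. \<rho>' x * H x)"
  proof (rule weak)
    show "(\<rho> has_real_derivative \<rho>' x) (at x)" for x
      unfolding \<rho>_def \<rho>'_def \<beta>_def using \<delta>(1) by (auto intro!: derivative_eq_intros)
    show "continuous_on UNIV \<rho>'"
      unfolding \<rho>'_def \<beta>_def using \<delta>(1) by (intro continuous_intros) auto
    show "0 \<le> \<rho> x" for x
      unfolding \<rho>_def using \<delta> by (auto intro!: smoothstep_mono simp: divide_simps)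
    show "s < s + \<delta>" "s + \<delta> < T - \<delta>" "T - \<delta> < T"
      using \<delta> by auto
    show "\<rho> x = 0 \<and> \<rho>' x = 0" if "x \<notin> {s + \<delta>..T - \<delta>}" for x
    proof
      show "\<rho>' x = 0" unfolding \<rho>'_def using that \<delta> by (auto simp: \<beta>0)
      show "\<rho> x = 0"
      proof (cases "x < s + \<delta>")
        case True
        then show ?thesis unfolding \<rho>_def using \<delta>
          by (simp add: smoothstep_eq_0 divide_nonpos_pos)
      next
        case False
        with that have "x > T - \<delta>" by auto
        then show ?thesis unfolding \<rho>_def using \<delta>
          by (subst (1 2) smoothstep_eq_1) (auto simp: field_simps)
      qed
    qed
  qed
  also have "\<dots> \<le> (LINT x|lborel. (H s + m) * \<beta> (s + \<delta>) x - (H T - m) * \<beta> (T - 2 * \<delta>) x)"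
  proof (rule integral_mono)
    have "integrable lborel (\<lambda>x. indicator {s..T} x *\<^sub>R (\<rho>' x * H x))"
      unfolding \<rho>'_def \<beta>_def using contH \<delta>(1)
      by (intro borel_integrable_compact continuous_intros) auto
    moreover have "indicator {s..T} x *\<^sub>R (\<rho>' x * H x) = \<rho>' x * H x" for x
    proof (cases "x \<in> {s..T}")
      case False
      then have "\<rho>' x = 0" unfolding \<rho>'_def using \<delta> by (subst (1 2) \<beta>0) auto
      then show ?thesis by simp
    qed simp
    ultimately show "integrable lborel (\<lambda>x. \<rho>' x * H x)" by (simp only:)
    show "integrable lborel (\<lambda>x. (H s + m) * \<beta> (s + \<delta>) x - (H T - m) * \<beta> (T - 2 * \<delta>) x)"
      using I\<beta> by auto
    show "\<rho>' x * H x \<le> (H s + m) * \<beta> (s + \<delta>) x - (H T - m) * \<beta> (T - 2 * \<delta>) x" for x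
    proof -
      have "\<beta> (s + \<delta>) x * H x \<le> \<beta> (s + \<delta>) x * (H s + m)"
      proof (cases "x \<in> {s + \<delta>..s + \<delta> + \<delta>}")
        case True
        then have "H x \<le> H s + m" using d1(2)[of x] \<delta> by (auto simp: abs_less_iff)
        then show ?thesis using \<beta>pos by (intro mult_left_mono) auto
      qed (simp add: \<beta>0)
      moreover have "\<beta> (T - 2*\<delta>) x * H x \<ge> \<beta> (T - 2*\<delta>) x * (H T - m)"
      proof (cases "x \<in> {T - 2*\<delta>..T - 2*\<delta> + \<delta>}")
        case True
        then have "H x \<ge> H T - m" using d2(2)[of x] \<delta> by (auto simp: abs_less_iff)
        then show ?thesis using \<beta>pos by (intro mult_left_mono) auto
      qed (simp add: \<beta>0)
      ultimately show ?thesis by (simp add: \<rho>'_def algebra_simps)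
    qed
  qed
  also have "\<dots> = (H s + m) - (H T - m)"
    using I\<beta> by simp
  also have "\<dots> < 0" using m by (simp add: m_def field_simps)
  finally show False by simp
qed

lemma integrable_bounded_times_continuous:
  fixes m w :: "'a::euclidean_space \<Rightarrow> real"
  assumes "m \<in> borel_measurable borel" and "\<And>x. \<bar>m x\<bar> \<le> B"
    and "continuous_on UNIV w" and "compact K" and "\<And>x. x \<notin> K \<Longrightarrow> w x = 0"
  shows "integrable lborel (\<lambda>x. m x * w x)"
proof -
  have "bounded (w ` K)"
    by (intro compact_imp_bounded compact_continuous_image assms continuous_on_subset[OF assms(3)]) auto
  then obtain c where c: "\<And>x. x \<in> K \<Longrightarrow> \<bar>w x\<bar> \<le> c"
    unfolding bounded_iff by auto
  show ?thesis
  proof (rule integrable_bounded_vanishing[OF _ assms(4)])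
    show "(\<lambda>x. m x * w x) \<in> borel_measurable borel"
      by (intro borel_measurable_times assms(1) borel_measurable_continuous_onI[OF assms(3)])
    show "\<bar>m x * w x\<bar> \<le> B * c" if "x \<in> K" for x
      unfolding abs_mult using assms(2)[of x] c[OF that] by (intro mult_mono) auto
  qed (simp add: assms(5))
qed

section \<open>Entropy inequalities on moving trapezoids\<close>

text \<open>\<open>\<eta>\<close> and \<open>q\<close> stand for an entropy and its flux already
  evaluated along the solution, as functions of time and space. This covers both |v - k| and the
  positive part of k - v. The bounds hold everywhere and not just almost everywhere, so every time
  slice can be integrated directly.\<close>

locale entropy_pair =
  fixes \<eta> q :: "real \<Rightarrow> real \<Rightarrow> real" and B :: real
  assumes measurable_\<eta>: "(\<lambda>p. \<eta> (fst p) (snd p)) \<in> borel_measurable borel"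
    and measurable_q: "(\<lambda>p. q (fst p) (snd p)) \<in> borel_measurable borel"
    and bounded_\<eta>: "\<bar>\<eta> t x\<bar> \<le> B" and bounded_q: "\<bar>q t x\<bar> \<le> B"
    and continuous_L1: "0 \<le> t \<Longrightarrow>
      ((\<lambda>s. LINT x:{-r..r}|lborel. \<bar>\<eta> s x - \<eta> t x\<bar>) \<longlongrightarrow> 0) (at t within {0..})"
    and entropy_ineq: "test_function \<phi> \<phi>t \<phi>x \<Longrightarrow>
      0 \<le> (LINT p:({0<..} \<times> UNIV)|lborel. \<eta> (fst p) (snd p) * \<phi>t p + q (fst p) (snd p) * \<phi>x p)"
begin

lemma B_nonneg: "0 \<le> B"
  using bounded_\<eta>[of 0 0] by linarith

lemma measurable_\<eta>_slice [measurable]: "\<eta> t \<in> borel_measurable borel"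
proof -
  have "(\<lambda>x. (t, x)) \<in> borel \<rightarrow>\<^sub>M borel"
    by (intro borel_measurable_continuous_onI continuous_intros)
  from measurable_compose[OF this measurable_\<eta>] show ?thesis by simp
qed

lemma measurable_q_slice [measurable]: "q t \<in> borel_measurable borel"
proof -
  have "(\<lambda>x. (t, x)) \<in> borel \<rightarrow>\<^sub>M borel"
    by (intro borel_measurable_continuous_onI continuous_intros)
  from measurable_compose[OF this measurable_q] show ?thesis by simp
qed

text \<open>The difference of the integrands at times \<tau> and t splits into (\<eta> \<tau> -
  \<eta> t) \<psi> \<tau> and \<eta> t (\<psi> \<tau> - \<psi> t). The first part is small by
  \<open>continuous_L1\<close> since |\<psi>| <= 1, the second by dominated convergence since
  |\<eta>| <= B.\<close>

lemma continuous_on_moment: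
  assumes cont: "continuous_on UNIV \<psi>" and "0 \<le> s"
    and supp: "\<And>\<tau> x. \<tau> \<in> {s..T} \<Longrightarrow> x \<notin> {-r..r} \<Longrightarrow> \<psi> (\<tau>, x) = 0"
    and le1: "\<And>p. \<bar>\<psi> p\<bar> \<le> 1"
  shows "continuous_on {s..T} (\<lambda>\<tau>. LINT x|lborel. \<eta> \<tau> x * \<psi> (\<tau>, x))"
  unfolding continuous_on_def
proof
  fix t assume t: "t \<in> {s..T}"
  have \<psi>_slice [measurable]: "(\<lambda>x. \<psi> (\<tau>, x)) \<in> borel_measurable borel" for \<tau>
    by (intro borel_measurable_continuous_onI continuous_on_compose2[OF cont] continuous_intros) auto
  have int: "integrable lborel (\<lambda>x. \<eta> \<tau> x * \<psi> (\<tau>', x))" if "\<tau>' \<in> {s..T}" for \<tau> \<tau>'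
  proof (rule integrable_bounded_vanishing[where K="{-r..r}" and c=B])
    show "\<bar>\<eta> \<tau> x * \<psi> (\<tau>', x)\<bar> \<le> B" for x
      using mult_mono[OF bounded_\<eta>[of \<tau> x] le1[of "(\<tau>', x)"]] B_nonneg by (simp add: abs_mult)
  qed (use supp[OF that] in auto)
  have "((\<lambda>\<tau>. (LINT x:{-r..r}|lborel. \<bar>\<eta> \<tau> x - \<eta> t x\<bar>)
        + (LINT x:{-r..r}|lborel. B * \<bar>\<psi> (\<tau>, x) - \<psi> (t, x)\<bar>)) \<longlongrightarrow> 0 + 0) (at t within {s..T})"
  proof (intro tendsto_add)
    show "((\<lambda>\<tau>. LINT x:{-r..r}|lborel. \<bar>\<eta> \<tau> x - \<eta> t x\<bar>) \<longlongrightarrow> 0) (at t within {s..T})"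
      using continuous_L1[of t r] t \<open>0 \<le> s\<close> by (rule_tac tendsto_within_subset) auto
    show "((\<lambda>\<tau>. LINT x:{-r..r}|lborel. B * \<bar>\<psi> (\<tau>, x) - \<psi> (t, x)\<bar>) \<longlongrightarrow> 0) (at t within {s..T})"
      unfolding set_lebesgue_integral_def tendsto_at_iff_sequentially comp_def
    proof (intro allI impI)
      fix X assume X: "\<forall>i. X i \<in> {s..T} - {t}" "X \<longlonglongrightarrow> t"
      have "(\<lambda>i. LINT x|lborel. indicator {-r..r} x *\<^sub>R (B * \<bar>\<psi> (X i, x) - \<psi> (t, x)\<bar>))
          \<longlonglongrightarrow> (LINT x|lborel. indicator {-r..r} x *\<^sub>R (B * \<bar>\<psi> (t, x) - \<psi> (t, x)\<bar>))"
      proof (rule integral_dominated_convergence[where w="\<lambda>x. indicator {-r..r} x * (2 * B)"])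
        show "integrable lborel (\<lambda>x. indicator {-r..r} x * (2 * B))"
          by (intro integrable_mult_left integrable_real_indicator) (auto simp: emeasure_lborel_Icc_eq)
        show "AE x in lborel. (\<lambda>i. indicator {-r..r} x *\<^sub>R (B * \<bar>\<psi> (X i, x) - \<psi> (t, x)\<bar>))
            \<longlonglongrightarrow> indicator {-r..r} x *\<^sub>R (B * \<bar>\<psi> (t, x) - \<psi> (t, x)\<bar>)"
          by (intro AE_I2 tendsto_intros continuous_on_tendsto_compose[OF cont] X) auto
        show "AE x in lborel. norm (indicator {-r..r} x *\<^sub>R (B * \<bar>\<psi> (X i, x) - \<psi> (t, x)\<bar>))
            \<le> indicator {-r..r} x * (2 * B)" for i
        proof (intro AE_I2)
          fix x
          have "\<bar>\<psi> (X i, x) - \<psi> (t, x)\<bar> \<le> 2"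
            using le1[of "(X i, x)"] le1[of "(t, x)"] by linarith
          from mult_left_mono[OF this B_nonneg]
          show "norm (indicator {-r..r} x *\<^sub>R (B * \<bar>\<psi> (X i, x) - \<psi> (t, x)\<bar>))
            \<le> indicator {-r..r} x * (2 * B)"
            using B_nonneg by (auto simp: indicator_def abs_mult)
        qed
      qed auto
      then show "(\<lambda>i. LINT x|lborel. indicator {-r..r} x *\<^sub>R (B * \<bar>\<psi> (X i, x) - \<psi> (t, x)\<bar>)) \<longlonglongrightarrow> 0"
        by simp
    qed
  qed
  then have lim: "((\<lambda>\<tau>. (LINT x:{-r..r}|lborel. \<bar>\<eta> \<tau> x - \<eta> t x\<bar>)
        + (LINT x:{-r..r}|lborel. B * \<bar>\<psi> (\<tau>, x) - \<psi> (t, x)\<bar>)) \<longlongrightarrow> 0) (at t within {s..T})" by simp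
  have "((\<lambda>\<tau>. (LINT x|lborel. \<eta> \<tau> x * \<psi> (\<tau>, x)) - (LINT x|lborel. \<eta> t x * \<psi> (t, x))) \<longlongrightarrow> 0)
      (at t within {s..T})"
  proof (rule Lim_null_comparison[OF _ lim])
    show "\<forall>\<^sub>F \<tau> in at t within {s..T}.
      norm ((LINT x|lborel. \<eta> \<tau> x * \<psi> (\<tau>, x)) - (LINT x|lborel. \<eta> t x * \<psi> (t, x)))
      \<le> (LINT x:{-r..r}|lborel. \<bar>\<eta> \<tau> x - \<eta> t x\<bar>)
        + (LINT x:{-r..r}|lborel. B * \<bar>\<psi> (\<tau>, x) - \<psi> (t, x)\<bar>)"
      unfolding eventually_at_filter
    proof (intro always_eventually allI impI)
      fix \<tau> assume \<tau>: "\<tau> \<in> {s..T}"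
      have i1: "integrable lborel (\<lambda>x. indicator {-r..r} x *\<^sub>R \<bar>\<eta> \<tau> x - \<eta> t x\<bar>)"
      proof (rule integrable_bounded_vanishing[where K="{-r..r}" and c="2*B"])
        show "\<bar>indicator {-r..r} x *\<^sub>R \<bar>\<eta> \<tau> x - \<eta> t x\<bar>\<bar> \<le> 2 * B" for x
          using bounded_\<eta>[of \<tau> x] bounded_\<eta>[of t x] B_nonneg by (auto simp: indicator_def)
      qed auto
      have i2: "integrable lborel (\<lambda>x. indicator {-r..r} x *\<^sub>R (B * \<bar>\<psi> (\<tau>, x) - \<psi> (t, x)\<bar>))"
      proof (rule integrable_bounded_vanishing[where K="{-r..r}" and c="B * 2"])
        show "\<bar>indicator {-r..r} x *\<^sub>R (B * \<bar>\<psi> (\<tau>, x) - \<psi> (t, x)\<bar>)\<bar> \<le> B * 2" for x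
        proof -
          have "\<bar>\<psi> (\<tau>, x) - \<psi> (t, x)\<bar> \<le> 2"
            using le1[of "(\<tau>, x)"] le1[of "(t, x)"] by linarith
          from mult_left_mono[OF this B_nonneg] show ?thesis
            using B_nonneg by (auto simp: indicator_def abs_mult)
        qed
      qed auto
      have "norm ((LINT x|lborel. \<eta> \<tau> x * \<psi> (\<tau>, x)) - (LINT x|lborel. \<eta> t x * \<psi> (t, x)))
          = norm (LINT x|lborel. \<eta> \<tau> x * \<psi> (\<tau>, x) - \<eta> t x * \<psi> (t, x))"
        using int \<tau> t by simp
      also have "\<dots> \<le> (LINT x|lborel. norm (\<eta> \<tau> x * \<psi> (\<tau>, x) - \<eta> t x * \<psi> (t, x)))"
        by (rule integral_norm_bound)
      also have "\<dots> \<le> (LINT x|lborel. indicator {-r..r} x *\<^sub>R \<bar>\<eta> \<tau> x - \<eta> t x\<bar>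
          + indicator {-r..r} x *\<^sub>R (B * \<bar>\<psi> (\<tau>, x) - \<psi> (t, x)\<bar>))"
      proof (rule integral_mono)
        fix x
        show "norm (\<eta> \<tau> x * \<psi> (\<tau>, x) - \<eta> t x * \<psi> (t, x)) \<le> indicator {-r..r} x *\<^sub>R \<bar>\<eta> \<tau> x - \<eta> t x\<bar>
          + indicator {-r..r} x *\<^sub>R (B * \<bar>\<psi> (\<tau>, x) - \<psi> (t, x)\<bar>)"
        proof (cases "x \<in> {-r..r}")
          case True
          have "\<eta> \<tau> x * \<psi> (\<tau>, x) - \<eta> t x * \<psi> (t, x)
              = (\<eta> \<tau> x - \<eta> t x) * \<psi> (\<tau>, x) + \<eta> t x * (\<psi> (\<tau>, x) - \<psi> (t, x))"
            by (simp add: algebra_simps)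
          also have "norm \<dots> \<le> \<bar>\<eta> \<tau> x - \<eta> t x\<bar> * \<bar>\<psi> (\<tau>, x)\<bar> + \<bar>\<eta> t x\<bar> * \<bar>\<psi> (\<tau>, x) - \<psi> (t, x)\<bar>"
            by (metis abs_mult abs_triangle_ineq real_norm_def)
          also have "\<dots> \<le> \<bar>\<eta> \<tau> x - \<eta> t x\<bar> * 1 + B * \<bar>\<psi> (\<tau>, x) - \<psi> (t, x)\<bar>"
            by (intro add_mono mult_left_mono mult_right_mono le1 bounded_\<eta>) auto
          finally show ?thesis using True by simp
        next
          case False
          then show ?thesis using supp \<tau> t by simp
        qed
      qed (use int i1 i2 \<tau> t in auto)
      also have "\<dots> = (LINT x:{-r..r}|lborel. \<bar>\<eta> \<tau> x - \<eta> t x\<bar>)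
        + (LINT x:{-r..r}|lborel. B * \<bar>\<psi> (\<tau>, x) - \<psi> (t, x)\<bar>)"
        unfolding set_lebesgue_integral_def by (rule Bochner_Integration.integral_add[OF i1 i2])
      finally show "norm ((LINT x|lborel. \<eta> \<tau> x * \<psi> (\<tau>, x)) - (LINT x|lborel. \<eta> t x * \<psi> (t, x)))
        \<le> (LINT x:{-r..r}|lborel. \<bar>\<eta> \<tau> x - \<eta> t x\<bar>)
        + (LINT x:{-r..r}|lborel. B * \<bar>\<psi> (\<tau>, x) - \<psi> (t, x)\<bar>)" .
    qed
  qed
  then show "((\<lambda>\<tau>. LINT x|lborel. \<eta> \<tau> x * \<psi> (\<tau>, x)) \<longlongrightarrow> (LINT x|lborel. \<eta> t x * \<psi> (t, x)))
      (at t within {s..T})"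
    by (rule Lim_transform_eq[THEN iffD2, OF _ tendsto_const, rotated]) 
qed

text \<open>Formally the moment of \<open>\<eta>\<close> against \<open>\<psi>\<close> has a time
  derivative of at most the integral in \<open>rate\<close>. Since \<open>\<psi>\<close> need not
  have compact support in time, it is multiplied by a time cutoff \<open>\<rho>\<close>; continuity
  of the moment then recovers the endpoints \<open>s\<close> and \<open>T\<close>.\<close>

lemma moment_growth_bound:
  assumes deriv: "\<And>p. (\<psi> has_derivative (\<lambda>h. \<psi>t p * fst h + \<psi>x p * snd h)) (at p)"
    and cont_t: "continuous_on UNIV \<psi>t" and cont_x: "continuous_on UNIV \<psi>x"
    and nonneg: "\<And>p. 0 \<le> \<psi> p" and le1: "\<And>p. \<psi> p \<le> 1"
    and "0 \<le> s" "s < T"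
    and supp: "\<And>\<tau> x. \<tau> \<in> {s..T} \<Longrightarrow> x \<notin> {-r..r} \<Longrightarrow> \<psi> (\<tau>, x) = 0 \<and> \<psi>t (\<tau>, x) = 0 \<and> \<psi>x (\<tau>, x) = 0"
    and rate: "\<And>\<tau>. s < \<tau> \<Longrightarrow> \<tau> < T \<Longrightarrow> (LINT x|lborel. \<eta> \<tau> x * \<psi>t (\<tau>, x) + q \<tau> x * \<psi>x (\<tau>, x)) \<le> D"
  shows "(LINT x|lborel. \<eta> T x * \<psi> (T, x)) \<le> (LINT x|lborel. \<eta> s x * \<psi> (s, x)) + D * (T - s)"
proof -
  define F where "F \<tau> = (LINT x|lborel. \<eta> \<tau> x * \<psi> (\<tau>, x))" for \<tau>
  have cont_\<psi>: "continuous_on UNIV \<psi>"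
    using deriv has_derivative_continuous continuous_at_imp_continuous_on by blast
  have contF: "continuous_on {s..T} F"
    unfolding F_def
    by (rule continuous_on_moment[OF cont_\<psi> \<open>0 \<le> s\<close>]) (use supp nonneg le1 in auto)
  have slice: "continuous_on UNIV (\<lambda>x. g (\<tau>, x))" if "continuous_on UNIV g"
    for g :: "real \<times> real \<Rightarrow> real" and \<tau> :: real
    by (intro continuous_on_compose2[OF that] continuous_intros) auto
  \<comment> \<open>Subtracting the line of slope \<open>D\<close> turns the growth bound into weak
    monotonicity.\<close>
  have "F T - D * T \<le> F s - D * s"
  proof (rule nonincreasing_endpoints_of_weak_derivative[OF \<open>s < T\<close>])
    show contH: "continuous_on {s..T} (\<lambda>x. F x - D * x)"
      by (intro continuous_intros contF)
    fix \<rho> \<rho>' a b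
    assume d\<rho>: "\<And>x::real. (\<rho> has_real_derivative \<rho>' x) (at x)" and c\<rho>': "continuous_on UNIV \<rho>'"
      and \<rho>0: "\<And>x. 0 \<le> \<rho> x" and ab: "s < a" "a < b" "b < T"
      and \<rho>K: "\<And>x. x \<notin> {a..b} \<Longrightarrow> \<rho> x = 0 \<and> \<rho>' x = 0"
    have c\<rho>: "continuous_on UNIV \<rho>"
      using d\<rho> DERIV_isCont continuous_at_imp_continuous_on by blast
    define \<phi> where "\<phi> p = \<rho> (fst p) * \<psi> p" for p
    define \<phi>t where "\<phi>t p = \<rho>' (fst p) * \<psi> p + \<rho> (fst p) * \<psi>t p" for p
    define \<phi>x where "\<phi>x p = \<rho> (fst p) * \<psi>x p" for p
    \<comment> \<open>Since a > s and s >= 0, this rectangle stays inside t > 0.\<close>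
    define K where "K = {a..b} \<times> {-r..r}"
    have K: "compact K" unfolding K_def by (intro compact_Times compact_Icc)
    have c\<phi>t: "continuous_on UNIV \<phi>t" and c\<phi>x: "continuous_on UNIV \<phi>x"
      unfolding \<phi>t_def \<phi>x_def
      by (intro continuous_intros cont_t cont_x cont_\<psi>
            continuous_on_compose2[OF c\<rho>] continuous_on_compose2[OF c\<rho>']; simp)+
    have offK: "\<phi> p = 0 \<and> \<phi>t p = 0 \<and> \<phi>x p = 0" if "p \<notin> K" for p
    proof (cases "fst p \<in> {a..b}")
      case True
      then have "snd p \<notin> {-r..r}" "fst p \<in> {s..T}"
        using that ab unfolding K_def by (cases p; auto)+
      then show ?thesis using supp[of "fst p" "snd p"] by (simp add: \<phi>_def \<phi>t_def \<phi>x_def)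
    qed (use \<rho>K in \<open>simp add: \<phi>_def \<phi>t_def \<phi>x_def\<close>)
    have test: "test_function \<phi> \<phi>t \<phi>x"
      unfolding test_function_def
    proof (intro conjI allI exI[of _ K])
      fix p :: "real \<times> real"
      have "((\<lambda>p. \<rho> (fst p)) has_derivative (\<lambda>h. \<rho>' (fst p) * fst h)) (at p)"
        using has_derivative_compose[OF has_derivative_fst[OF has_derivative_ident]
            d\<rho>[of "fst p", unfolded has_field_derivative_def]]
        by simp
      from has_derivative_mult[OF this deriv[of p]]
      show "(\<phi> has_derivative (\<lambda>h. \<phi>t p * fst h + \<phi>x p * snd h)) (at p)"
        unfolding \<phi>_def \<phi>t_def \<phi>x_def by (simp add: algebra_simps)
      show "0 \<le> \<phi> p" unfolding \<phi>_def using \<rho>0 nonneg by simp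
    next
      show "K \<subseteq> {0<..} \<times> UNIV" using ab \<open>0 \<le> s\<close> by (auto simp: K_def)
      show "p \<notin> K \<longrightarrow> \<phi> p = 0" for p using offK by blast
    qed (fact c\<phi>t c\<phi>x K)+
    define h where "h p = \<eta> (fst p) (snd p) * \<phi>t p + q (fst p) (snd p) * \<phi>x p" for p
    have int_h: "integrable lborel h"
      unfolding h_def using offK bounded_\<eta> bounded_q
      by (intro Bochner_Integration.integrable_add integrable_bounded_times_continuous[OF _ _ _ K]
          measurable_\<eta> measurable_q c\<phi>t c\<phi>x) auto
    then have int_h': "integrable (lborel \<Otimes>\<^sub>M lborel) h" by (simp add: lborel_prod)
    have "0 \<le> (LINT p:({0<..} \<times> UNIV)|lborel. h p)"
      using entropy_ineq[OF test] by (simp add: h_def)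
    also have "\<dots> = (LINT p|lborel. h p)"
      unfolding set_lebesgue_integral_def
    proof (rule Bochner_Integration.integral_cong[OF refl])
      fix p
      have "h p = 0" if "p \<notin> {0<..} \<times> UNIV"
        using offK[of p] that ab \<open>0 \<le> s\<close> by (cases p) (auto simp: K_def h_def)
      then show "indicator ({0<..} \<times> UNIV) p *\<^sub>R h p = h p"
        by (auto simp: indicator_def)
    qed
    also have "\<dots> = (LINT \<tau>|lborel. LINT x|lborel. h (\<tau>, x))"
      using lborel_pair.integral_fst'[OF int_h'] by (simp add: lborel_prod)
    \<comment> \<open>The right-hand integrand is \<rho>' F + D \<rho>, rearranged so that its
      second summand is \<open>D\<close> times the derivative of
      \<open>\<rho> \<tau> * \<tau>\<close>. That summand integrates to 0 because
      \<open>\<rho>\<close> vanishes at \<open>s\<close> and \<open>T\<close>.\<close>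
    also have "\<dots> \<le> (LINT \<tau>|lborel. \<rho>' \<tau> * (F \<tau> - D * \<tau>) + D * (\<rho>' \<tau> * \<tau> + \<rho> \<tau>))"
    proof (rule integral_mono)
      show "integrable lborel (\<lambda>\<tau>. LINT x|lborel. h (\<tau>, x))"
        using lborel_pair.integrable_fst'[OF int_h'] by simp
      have "integrable lborel (\<lambda>\<tau>. indicator {s..T} \<tau> *\<^sub>R (\<rho>' \<tau> * (F \<tau> - D * \<tau>) + D * (\<rho>' \<tau> * \<tau> + \<rho> \<tau>)))"
        by (intro borel_integrable_compact continuous_intros contF
            continuous_on_subset[OF c\<rho>] continuous_on_subset[OF c\<rho>']) auto
      moreover have "indicator {s..T} \<tau> *\<^sub>R (\<rho>' \<tau> * (F \<tau> - D * \<tau>) + D * (\<rho>' \<tau> * \<tau> + \<rho> \<tau>))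
          = \<rho>' \<tau> * (F \<tau> - D * \<tau>) + D * (\<rho>' \<tau> * \<tau> + \<rho> \<tau>)" for \<tau>
        by (cases "\<tau> \<in> {a..b}") (use \<rho>K[of \<tau>] ab in \<open>auto simp: indicator_def\<close>)
      ultimately show "integrable lborel (\<lambda>\<tau>. \<rho>' \<tau> * (F \<tau> - D * \<tau>) + D * (\<rho>' \<tau> * \<tau> + \<rho> \<tau>))"
        by (simp only:)
      fix \<tau>
      show "(LINT x|lborel. h (\<tau>, x)) \<le> \<rho>' \<tau> * (F \<tau> - D * \<tau>) + D * (\<rho>' \<tau> * \<tau> + \<rho> \<tau>)"
      proof (cases "\<tau> \<in> {a..b}")
        case False
        then show ?thesis using \<rho>K[OF False] by (simp add: h_def \<phi>t_def \<phi>x_def)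
      next
        case True
        then have \<tau>: "s < \<tau>" "\<tau> < T" "\<tau> \<in> {s..T}" using ab by auto
        have i: "integrable lborel (\<lambda>x. \<eta> \<tau> x * \<psi> (\<tau>, x))" "integrable lborel (\<lambda>x. \<eta> \<tau> x * \<psi>t (\<tau>, x))"
            "integrable lborel (\<lambda>x. q \<tau> x * \<psi>x (\<tau>, x))"
          using supp[OF \<tau>(3)] bounded_\<eta> bounded_q
          by (auto intro!: integrable_bounded_times_continuous[of _ _ _ "{-r..r}"] slice cont_t cont_x cont_\<psi>)
        have "(LINT x|lborel. h (\<tau>, x)) = (LINT x|lborel. \<rho>' \<tau> * (\<eta> \<tau> x * \<psi> (\<tau>, x))
            + \<rho> \<tau> * (\<eta> \<tau> x * \<psi>t (\<tau>, x) + q \<tau> x * \<psi>x (\<tau>, x)))"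
          by (intro Bochner_Integration.integral_cong) (auto simp: h_def \<phi>t_def \<phi>x_def algebra_simps)
        also have "\<dots> = \<rho>' \<tau> * F \<tau> + \<rho> \<tau> * (LINT x|lborel. \<eta> \<tau> x * \<psi>t (\<tau>, x) + q \<tau> x * \<psi>x (\<tau>, x))"
          using i by (simp add: F_def)
        also have "\<dots> \<le> \<rho>' \<tau> * F \<tau> + \<rho> \<tau> * D"
          using rate[OF \<tau>(1,2)] \<rho>0[of \<tau>] by (intro add_left_mono mult_left_mono)
        finally show ?thesis by (simp add: algebra_simps)
      qed
    qed
    also have "\<dots> = (LINT \<tau>|lborel. \<rho>' \<tau> * (F \<tau> - D * \<tau>))"
    proof -
      have g: "((\<lambda>\<tau>. \<rho> \<tau> * \<tau>) has_real_derivative (\<rho>' \<tau> * \<tau> + \<rho> \<tau>)) (at \<tau>)" for \<tau>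
        using d\<rho> by (auto intro!: derivative_eq_intros)
      have "continuous_on UNIV (\<lambda>\<tau>. \<rho>' \<tau> * \<tau> + \<rho> \<tau>)" by (intro continuous_intros c\<rho> c\<rho>')
      moreover have "\<rho>' \<tau> * \<tau> + \<rho> \<tau> = 0" if "\<tau> \<notin> {s..T}" for \<tau>
        using \<rho>K[of \<tau>] that ab by auto
      ultimately have "integrable lborel (\<lambda>\<tau>. \<rho>' \<tau> * \<tau> + \<rho> \<tau>)"
          "(LINT \<tau>|lborel. \<rho>' \<tau> * \<tau> + \<rho> \<tau>) = \<rho> T * T - \<rho> s * s"
        using integral_deriv_vanishing[OF g, of s T] \<open>s < T\<close> by auto
      then have i1: "integrable lborel (\<lambda>\<tau>. \<rho>' \<tau> * \<tau> + \<rho> \<tau>)" "(LINT \<tau>|lborel. \<rho>' \<tau> * \<tau> + \<rho> \<tau>) = 0"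
        using \<rho>K[of s] \<rho>K[of T] ab by auto
      have "integrable lborel (\<lambda>\<tau>. indicator {s..T} \<tau> *\<^sub>R (\<rho>' \<tau> * (F \<tau> - D * \<tau>)))"
        by (intro borel_integrable_compact continuous_intros contF continuous_on_subset[OF c\<rho>']) auto
      moreover have "indicator {s..T} \<tau> *\<^sub>R (\<rho>' \<tau> * (F \<tau> - D * \<tau>)) = \<rho>' \<tau> * (F \<tau> - D * \<tau>)" for \<tau>
        by (cases "\<tau> \<in> {a..b}") (use \<rho>K[of \<tau>] ab in \<open>auto simp: indicator_def\<close>)
      ultimately have "integrable lborel (\<lambda>\<tau>. \<rho>' \<tau> * (F \<tau> - D * \<tau>))" by (simp only:)
      with i1 show ?thesis by simp
    qed
    finally show "0 \<le> (LINT \<tau>|lborel. \<rho>' \<tau> * (F \<tau> - D * \<tau>))" .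
  qed
  then show ?thesis by (simp add: F_def algebra_simps)
qed

text \<open>The cutoff lives between the edges x = a + c \<tau> and x = b + d \<tau>, with ramps of
  width \<delta> on the inner side. Differentiating it produces ramp densities times q - c \<eta> on
  the left and - (q - d \<eta>) on the right, the fluxes relative to the moving edges. The left one
  contributes at most \<open>e\<close> per unit time, and the right one has a favourable
  sign.\<close>

lemma trapezoid_bound:
  assumes \<psi>: "\<psi> = (\<lambda>\<tau> x. smoothstep ((x - c * \<tau> - a) / \<delta>) * smoothstep ((b + d * \<tau> - x) / \<delta>))"
    and "\<delta> > 0" "0 \<le> s" "s < T" "0 \<le> e"
    and left: "\<And>\<tau>. s < \<tau> \<Longrightarrow> \<tau> < T \<Longrightarrow> AE x in lborel.
      a + c * \<tau> < x \<longrightarrow> x < a + c * \<tau> + \<delta> \<longrightarrow> x < b + d * \<tau> \<longrightarrow> q \<tau> x - c * \<eta> \<tau> x \<le> e"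
    and right: "\<And>\<tau>. s < \<tau> \<Longrightarrow> \<tau> < T \<Longrightarrow> AE x in lborel.
      a + c * \<tau> < x \<longrightarrow> b + d * \<tau> - \<delta> < x \<longrightarrow> x < b + d * \<tau> \<longrightarrow> 0 \<le> q \<tau> x - d * \<eta> \<tau> x"
  shows "(LINT x|lborel. \<eta> T x * \<psi> T x) \<le> (LINT x|lborel. \<eta> s x * \<psi> s x) + e * (T - s)"
proof -
  define \<alpha> where "\<alpha> p = (snd p - c * fst p - a) / \<delta>" for p :: "real \<times> real"
  define \<beta> where "\<beta> p = (b + d * fst p - snd p) / \<delta>" for p :: "real \<times> real"
  \<comment> \<open>\<open>A'\<close> and \<open>B'\<close> are the contributions of the left and
    the right ramp to the x-derivative, up to sign; the edge speeds enter as factors in the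
    t-derivative.\<close>
  define A' where "A' p = smoothstep_deriv (\<alpha> p) * smoothstep (\<beta> p) / \<delta>" for p
  define B' where "B' p = smoothstep (\<alpha> p) * smoothstep_deriv (\<beta> p) / \<delta>" for p
  define \<psi>t where "\<psi>t p = d * B' p - c * A' p" for p
  define \<psi>x where "\<psi>x p = A' p - B' p" for p
  \<comment> \<open>Both edges stay in [-r, r] for times between 0 and \<open>T\<close>, whatever
    the signs of the speeds.\<close>
  define r where "r = \<bar>a\<bar> + \<bar>c\<bar> * T + \<bar>b\<bar> + \<bar>d\<bar> * T"
  have c\<alpha>: "continuous_on UNIV \<alpha>" and c\<beta>: "continuous_on UNIV \<beta>"
    unfolding \<alpha>_def \<beta>_def using \<open>\<delta> > 0\<close> by (auto intro!: continuous_intros)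
  have cA': "continuous_on UNIV A'" and cB': "continuous_on UNIV B'"
    unfolding A'_def B'_def using \<open>\<delta> > 0\<close> by (auto intro!: continuous_intros c\<alpha> c\<beta>)
  have sm: "(smoothstep has_derivative (\<lambda>h. smoothstep_deriv y * h)) (at y)" for y
    using DERIV_smoothstep[OF DERIV_ident, of y UNIV] by (simp add: has_field_derivative_def)
  have A'_nonneg: "0 \<le> A' p" and B'_nonneg: "0 \<le> B' p" for p
    using \<open>\<delta> > 0\<close> by (simp_all add: A'_def B'_def smoothstep_nonneg smoothstep_deriv_nonneg)
  have zero: "\<alpha> (\<tau>, x) \<le> 0 \<or> \<beta> (\<tau>, x) \<le> 0" if "\<tau> \<in> {s..T}" "x \<notin> {-r..r}" for \<tau> x
  proof -
    have "\<bar>c * \<tau>\<bar> \<le> \<bar>c\<bar> * T" "\<bar>d * \<tau>\<bar> \<le> \<bar>d\<bar> * T"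
      using that(1) \<open>0 \<le> s\<close> by (auto simp: abs_mult intro!: mult_left_mono)
    then have "x \<le> a + c * \<tau> \<or> b + d * \<tau> \<le> x"
      using that(2) unfolding r_def by (auto simp: not_le)
    then show ?thesis using \<open>\<delta> > 0\<close> by (auto simp: \<alpha>_def \<beta>_def divide_le_0_iff)
  qed
  have zero': "smoothstep (\<alpha> p) * smoothstep (\<beta> p) = 0 \<and> \<psi>t p = 0 \<and> \<psi>x p = 0"
    if "\<alpha> p \<le> 0 \<or> \<beta> p \<le> 0" for p
    using that by (auto simp: \<psi>t_def \<psi>x_def A'_def B'_def smoothstep_eq_0 smoothstep_deriv_eq_0)
  have *: "\<psi> \<tau> x = smoothstep (\<alpha> (\<tau>, x)) * smoothstep (\<beta> (\<tau>, x))" for \<tau> x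
    by (simp add: \<psi> \<alpha>_def \<beta>_def)
  show ?thesis
    unfolding *
  proof (rule moment_growth_bound[where \<psi>="\<lambda>p. smoothstep (\<alpha> p) * smoothstep (\<beta> p)" and \<psi>t=\<psi>t and \<psi>x=\<psi>x and r=r])
    fix p
    have "(\<alpha> has_derivative (\<lambda>h. (snd h - c * fst h) / \<delta>)) (at p)"
         "(\<beta> has_derivative (\<lambda>h. (d * fst h - snd h) / \<delta>)) (at p)"
      unfolding \<alpha>_def \<beta>_def using \<open>\<delta> > 0\<close> by (auto intro!: derivative_eq_intros)
    then have "((\<lambda>p. smoothstep (\<alpha> p)) has_derivative (\<lambda>h. smoothstep_deriv (\<alpha> p) * ((snd h - c * fst h) / \<delta>))) (at p)"
         "((\<lambda>p. smoothstep (\<beta> p)) has_derivative (\<lambda>h. smoothstep_deriv (\<beta> p) * ((d * fst h - snd h) / \<delta>))) (at p)"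
      using has_derivative_compose[OF _ sm] by blast+
    from has_derivative_mult[OF this]
    show "((\<lambda>p. smoothstep (\<alpha> p) * smoothstep (\<beta> p)) has_derivative (\<lambda>h. \<psi>t p * fst h + \<psi>x p * snd h)) (at p)"
      by (rule has_derivative_eq_rhs)
         (use \<open>\<delta> > 0\<close> in \<open>simp add: \<psi>t_def \<psi>x_def A'_def B'_def fun_eq_iff field_simps\<close>)
    show "0 \<le> smoothstep (\<alpha> p) * smoothstep (\<beta> p)" by (simp add: smoothstep_nonneg)
    show "smoothstep (\<alpha> p) * smoothstep (\<beta> p) \<le> 1"
      by (intro mult_le_one smoothstep_le_1 smoothstep_nonneg)
  next
    show "continuous_on UNIV \<psi>t" "continuous_on UNIV \<psi>x"
      unfolding \<psi>t_def \<psi>x_def by (intro continuous_intros cA' cB')+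
    show "smoothstep (\<alpha> (\<tau>, x)) * smoothstep (\<beta> (\<tau>, x)) = 0 \<and> \<psi>t (\<tau>, x) = 0 \<and> \<psi>x (\<tau>, x) = 0"
      if "\<tau> \<in> {s..T}" "x \<notin> {-r..r}" for \<tau> x
      using zero' zero[OF that] by blast
  next
    fix \<tau> assume \<tau>: "s < \<tau>" "\<tau> < T"
    have \<tau>': "\<tau> \<in> {s..T}" using \<tau> by simp
    \<comment> \<open>The full density of the left ramp dominates \<open>A'\<close>, because the
      other cutoff is at most 1, and it has integral 1.\<close>
    let ?w = "\<lambda>x. smoothstep_deriv ((x - (c * \<tau> + a)) / \<delta>) / \<delta>"
    have slice: "continuous_on UNIV (\<lambda>x. g (\<tau>, x))" if "continuous_on UNIV g" for g :: "real \<times> real \<Rightarrow> real"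
      by (intro continuous_on_compose2[OF that] continuous_intros) auto
    have "(LINT x|lborel. \<eta> \<tau> x * \<psi>t (\<tau>, x) + q \<tau> x * \<psi>x (\<tau>, x)) \<le> (LINT x|lborel. e * ?w x)"
    proof (rule integral_mono_AE)
      show "integrable lborel (\<lambda>x. e * ?w x)"
        using integral_smoothstep_deriv(1)[OF \<open>\<delta> > 0\<close>] by (rule integrable_mult_right)
      show "integrable lborel (\<lambda>x. \<eta> \<tau> x * \<psi>t (\<tau>, x) + q \<tau> x * \<psi>x (\<tau>, x))"
        using zero'[OF zero[OF \<tau>']] bounded_\<eta> bounded_q
        by (auto intro!: Bochner_Integration.integrable_add
            integrable_bounded_times_continuous[of _ _ _ "{-r..r}"] slice continuous_intros cA' cB'
            simp: \<psi>t_def[abs_def] \<psi>x_def[abs_def])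
      show "AE x in lborel. \<eta> \<tau> x * \<psi>t (\<tau>, x) + q \<tau> x * \<psi>x (\<tau>, x) \<le> e * ?w x"
        using left[OF \<tau>] right[OF \<tau>]
      proof eventually_elim
        fix x
        assume l: "a + c * \<tau> < x \<longrightarrow> x < a + c * \<tau> + \<delta> \<longrightarrow> x < b + d * \<tau> \<longrightarrow> q \<tau> x - c * \<eta> \<tau> x \<le> e"
          and r: "a + c * \<tau> < x \<longrightarrow> b + d * \<tau> - \<delta> < x \<longrightarrow> x < b + d * \<tau> \<longrightarrow> 0 \<le> q \<tau> x - d * \<eta> \<tau> x"
        have "A' (\<tau>, x) * (q \<tau> x - c * \<eta> \<tau> x) \<le> e * ?w x"
        proof (cases "0 < \<alpha> (\<tau>, x) \<and> \<alpha> (\<tau>, x) < 1 \<and> 0 < \<beta> (\<tau>, x)")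
          case True
          then have "q \<tau> x - c * \<eta> \<tau> x \<le> e"
            using l \<open>\<delta> > 0\<close> by (simp add: \<alpha>_def \<beta>_def divide_simps)
          then have "A' (\<tau>, x) * (q \<tau> x - c * \<eta> \<tau> x) \<le> A' (\<tau>, x) * e"
            by (intro mult_left_mono A'_nonneg)
          also have "A' (\<tau>, x) \<le> smoothstep_deriv (\<alpha> (\<tau>, x)) / \<delta>"
            using mult_left_le[of "smoothstep (\<beta> (\<tau>, x))" "smoothstep_deriv (\<alpha> (\<tau>, x))"]
              smoothstep_le_1 smoothstep_deriv_nonneg \<open>\<delta> > 0\<close>
            by (simp add: A'_def divide_right_mono)
          also have "\<dots> = ?w x" by (simp add: \<alpha>_def algebra_simps)
          finally show ?thesis using \<open>0 \<le> e\<close> by (simp add: mult.commute mult_right_mono)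
        next
          case False
          then have "A' (\<tau>, x) = 0"
            by (auto simp: A'_def not_less smoothstep_eq_0 smoothstep_deriv_eq_0)
          then show ?thesis using \<open>0 \<le> e\<close> \<open>\<delta> > 0\<close> by (simp add: smoothstep_deriv_nonneg)
        qed
        moreover have "0 \<le> B' (\<tau>, x) * (q \<tau> x - d * \<eta> \<tau> x)"
        proof (cases "0 < \<beta> (\<tau>, x) \<and> \<beta> (\<tau>, x) < 1 \<and> 0 < \<alpha> (\<tau>, x)")
          case True
          then have "0 \<le> q \<tau> x - d * \<eta> \<tau> x"
            using r \<open>\<delta> > 0\<close> by (simp add: \<alpha>_def \<beta>_def divide_simps)
          then show ?thesis by (simp add: B'_nonneg)
        next
          case False
          then have "B' (\<tau>, x) = 0"
            by (auto simp: B'_def not_less smoothstep_eq_0 smoothstep_deriv_eq_0)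
          then show ?thesis by simp
        qed
        ultimately show "\<eta> \<tau> x * \<psi>t (\<tau>, x) + q \<tau> x * \<psi>x (\<tau>, x) \<le> e * ?w x"
          unfolding \<psi>t_def \<psi>x_def by (simp add: algebra_simps)
      qed
    qed
    also have "\<dots> = e"
      using integral_smoothstep_deriv[OF \<open>\<delta> > 0\<close>] by simp
    finally show "(LINT x|lborel. \<eta> \<tau> x * \<psi>t (\<tau>, x) + q \<tau> x * \<psi>x (\<tau>, x)) \<le> e" .
  qed (fact assms)+
qed

lemma integrable_\<eta>_trapezoid:
  assumes "\<delta> > 0"
  shows "integrable lborel (\<lambda>x. \<eta> s x * (smoothstep ((x - a) / \<delta>) * smoothstep ((b - x) / \<delta>)))"
proof (rule integrable_bounded_times_continuous[where K="{a..b}"])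
  show "smoothstep ((x - a) / \<delta>) * smoothstep ((b - x) / \<delta>) = 0" if "x \<notin> {a..b}" for x
    using that assms by (auto simp: not_le divide_nonpos_pos smoothstep_eq_0)
qed (use assms bounded_\<eta> in \<open>auto intro!: continuous_intros\<close>)

text \<open>A domain of dependence argument: with relative flux bound 0, the weighted integral of a
  nonnegative entropy cannot grow from its initial value 0, and the weight is positive everywhere
  strictly between the edges.\<close>

lemma trapezoid_vanishing:
  assumes "\<delta> > 0" "0 \<le> s" "s < T" and \<eta>_nonneg: "\<And>\<tau> x. 0 \<le> \<eta> \<tau> x"
    and left: "\<And>\<tau>. s < \<tau> \<Longrightarrow> \<tau> < T \<Longrightarrow> AE x in lborel.
      a + c * \<tau> < x \<longrightarrow> x < a + c * \<tau> + \<delta> \<longrightarrow> x < b + d * \<tau> \<longrightarrow> q \<tau> x \<le> c * \<eta> \<tau> x"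
    and right: "\<And>\<tau>. s < \<tau> \<Longrightarrow> \<tau> < T \<Longrightarrow> AE x in lborel.
      a + c * \<tau> < x \<longrightarrow> b + d * \<tau> - \<delta> < x \<longrightarrow> x < b + d * \<tau> \<longrightarrow> d * \<eta> \<tau> x \<le> q \<tau> x"
    and init: "AE x in lborel. a + c * s < x \<longrightarrow> x < b + d * s \<longrightarrow> \<eta> s x = 0"
  shows "AE x in lborel. a + c * T < x \<longrightarrow> x < b + d * T \<longrightarrow> \<eta> T x = 0"
proof -
  define \<psi> where "\<psi> \<tau> x = smoothstep ((x - c * \<tau> - a) / \<delta>) * smoothstep ((b + d * \<tau> - x) / \<delta>)" for \<tau> x
  have i: "integrable lborel (\<lambda>x. \<eta> \<tau> x * \<psi> \<tau> x)" for \<tau>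
    using integrable_\<eta>_trapezoid[OF \<open>\<delta> > 0\<close>, of \<tau> "a + c * \<tau>" "b + d * \<tau>"]
    unfolding \<psi>_def by (simp add: algebra_simps)
  have "(LINT x|lborel. \<eta> T x * \<psi> T x) \<le> (LINT x|lborel. \<eta> s x * \<psi> s x) + 0 * (T - s)"
  proof (rule trapezoid_bound[of \<psi> c a \<delta> b d])
    show "\<psi> = (\<lambda>\<tau> x. smoothstep ((x - c * \<tau> - a) / \<delta>) * smoothstep ((b + d * \<tau> - x) / \<delta>))"
      by (simp add: \<psi>_def fun_eq_iff)
  qed (use assms in auto)
  also have "(LINT x|lborel. \<eta> s x * \<psi> s x) = 0"
  proof -
    have "AE x in lborel. \<eta> s x * \<psi> s x = 0"
      using init
    proof eventually_elim
      case (elim x)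
      then consider "x \<le> a + c * s" | "b + d * s \<le> x" | "\<eta> s x = 0" by fastforce
      then show ?case
        using \<open>\<delta> > 0\<close> by cases (auto simp: \<psi>_def divide_nonpos_pos smoothstep_eq_0)
    qed
    then show ?thesis by (rule integral_eq_zero_AE)
  qed
  finally have "(LINT x|lborel. \<eta> T x * \<psi> T x) \<le> 0" by simp
  moreover have nn: "0 \<le> \<eta> T x * \<psi> T x" for x
    by (simp add: \<psi>_def \<eta>_nonneg smoothstep_nonneg)
  ultimately have "(LINT x|lborel. \<eta> T x * \<psi> T x) = 0"
    by (meson Bochner_Integration.integral_nonneg order_antisym)
  then have "AE x in lborel. \<eta> T x * \<psi> T x = 0"
    using integral_nonneg_eq_0_iff_AE[OF i[of T]] nn by auto
  then show ?thesis
  proof eventually_elim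
    case (elim x)
    show ?case
    proof (intro impI)
      assume "a + c * T < x" "x < b + d * T"
      then have "0 < \<psi> T x" unfolding \<psi>_def
        using \<open>\<delta> > 0\<close> by (intro mult_pos_pos smoothstep_pos) auto
      with elim show "\<eta> T x = 0" by simp
    qed
  qed
qed

end

section \<open>Bounded entropy solutions\<close>

text \<open>\<open>test_function\<close> asks only \<phi> itself to vanish off a compact set. The
  complement of that set is open, so the partial derivatives vanish there as well.\<close>

lemma test_function_derivatives:
  assumes "test_function \<phi> \<phi>t \<phi>x"
  obtains K where "compact K" "K \<subseteq> {0<..} \<times> UNIV"
    "\<And>p. p \<notin> K \<Longrightarrow> \<phi> p = 0 \<and> \<phi>t p = 0 \<and> \<phi>x p = 0"
proof -
  from assms obtain K where K: "compact K" "K \<subseteq> {0<..} \<times> UNIV" "\<And>p. p \<notin> K \<Longrightarrow> \<phi> p = 0"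
    and d: "\<And>p. (\<phi> has_derivative (\<lambda>h. \<phi>t p * fst h + \<phi>x p * snd h)) (at p)"
    unfolding test_function_def by blast
  have "\<phi> p = 0 \<and> \<phi>t p = 0 \<and> \<phi>x p = 0" if "p \<notin> K" for p
  proof -
    have "(\<phi> has_derivative (\<lambda>h. 0)) (at p)"
      by (rule has_derivative_transform_within_open[OF has_derivative_const, of "- K"])
         (use K that compact_imp_closed[OF K(1)] in \<open>auto simp: open_Compl\<close>)
    from has_derivative_unique[OF d this]
    have "\<And>h. \<phi>t p * fst h + \<phi>x p * snd h = 0" by (simp add: fun_eq_iff)
    from this[of "(1, 0)"] this[of "(0, 1)"] show ?thesis using K(3)[OF that] by simp
  qed
  with K that show ?thesis by blast
qed

text \<open>By Fubini each integral reduces to differences of values of \<phi> far out, which are 0.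
  This is why adding constants to an entropy and to its flux leaves the weak inequality
  unchanged.\<close>

lemma test_function_integrals:
  assumes "test_function \<phi> \<phi>t \<phi>x"
  shows "(LINT p:({0<..} \<times> UNIV)|lborel. \<phi>t p) = 0" and "(LINT p:({0<..} \<times> UNIV)|lborel. \<phi>x p) = 0"
proof -
  obtain K where K: "compact K" "K \<subseteq> {0<..} \<times> UNIV" "\<And>p. p \<notin> K \<Longrightarrow> \<phi> p = 0 \<and> \<phi>t p = 0 \<and> \<phi>x p = 0"
    using test_function_derivatives[OF assms] by blast
  have d: "\<And>p. (\<phi> has_derivative (\<lambda>h. \<phi>t p * fst h + \<phi>x p * snd h)) (at p)"
    and c: "continuous_on UNIV \<phi>t" "continuous_on UNIV \<phi>x"
    using assms unfolding test_function_def by blast+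
  have int: "integrable (lborel \<Otimes>\<^sub>M lborel) \<phi>t" "integrable (lborel \<Otimes>\<^sub>M lborel) \<phi>x"
    using integrable_bounded_times_continuous[of "\<lambda>_. 1" 1 _ K] K c by (auto simp: lborel_prod)
  have ind: "(LINT p:({0<..} \<times> UNIV)|lborel. g p) = (LINT p|lborel. g p)"
    if "\<And>p. p \<notin> K \<Longrightarrow> g p = 0" for g :: "real \<times> real \<Rightarrow> real"
    unfolding set_lebesgue_integral_def using K(2) that
    by (intro Bochner_Integration.integral_cong refl) (auto simp: indicator_def)
  obtain R where R: "\<And>p. p \<in> K \<Longrightarrow> norm p \<le> R"
    using compact_imp_bounded[OF K(1)] unfolding bounded_iff by blast
  define r where "r = \<bar>R\<bar> + 1"
  have r: "r > 0" by (simp add: r_def)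
  have off: "\<phi> (t, x) = 0 \<and> \<phi>t (t, x) = 0 \<and> \<phi>x (t, x) = 0" if "r \<le> \<bar>t\<bar> \<or> r \<le> \<bar>x\<bar>" for t x
  proof -
    have "(t, x) \<notin> K"
    proof
      assume "(t, x) \<in> K"
      then have "norm (t, x) \<le> R" by (rule R)
      moreover have "\<bar>t\<bar> \<le> norm (t, x)" "\<bar>x\<bar> \<le> norm (t, x)"
        using norm_fst_le[of t x] norm_snd_le[of x t] by auto
      ultimately show False using that by (auto simp: r_def)
    qed
    then show ?thesis by (rule K(3))
  qed
  have "(LINT x|lborel. \<phi>x (t, x)) = 0" for t
  proof -
    have "(LINT x|lborel. \<phi>x (t, x)) = \<phi> (t, r) - \<phi> (t, -r)"
    proof (rule integral_deriv_vanishing(2)[where g="\<lambda>x. \<phi> (t, x)"])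
      show "((\<lambda>x. \<phi> (t, x)) has_real_derivative \<phi>x (t, x)) (at x)" for x
        using has_derivative_compose[OF has_derivative_Pair[OF has_derivative_const has_derivative_ident] d]
        unfolding has_field_derivative_def by simp
      show "continuous_on UNIV (\<lambda>x. \<phi>x (t, x))"
        by (intro continuous_on_compose2[OF c(2)] continuous_intros) auto
    qed (use r off in \<open>auto simp: not_le\<close>)
    then show ?thesis using off[of t r] off[of t "- r"] r by simp
  qed
  moreover have "(LINT p|lborel. \<phi>x p) = (LINT t|lborel. LINT x|lborel. \<phi>x (t, x))"
    using lborel_pair.integral_fst'[OF int(2)] by (simp add: lborel_prod)
  ultimately show "(LINT p:({0<..} \<times> UNIV)|lborel. \<phi>x p) = 0" using ind[of \<phi>x] K(3) by simp
  have "(LINT t|lborel. \<phi>t (t, x)) = 0" for x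
  proof -
    have "(LINT t|lborel. \<phi>t (t, x)) = \<phi> (r, x) - \<phi> (-r, x)"
    proof (rule integral_deriv_vanishing(2)[where g="\<lambda>t. \<phi> (t, x)"])
      show "((\<lambda>t. \<phi> (t, x)) has_real_derivative \<phi>t (t, x)) (at t)" for t
        using has_derivative_compose[OF has_derivative_Pair[OF has_derivative_ident has_derivative_const] d]
        unfolding has_field_derivative_def by simp
      show "continuous_on UNIV (\<lambda>t. \<phi>t (t, x))"
        by (intro continuous_on_compose2[OF c(1)] continuous_intros) auto
    qed (use r off in \<open>auto simp: not_le\<close>)
    then show ?thesis using off[of r x] off[of "- r" x] r by simp
  qed
  moreover have "(LINT p|lborel. \<phi>t p) = (LINT x|lborel. LINT t|lborel. \<phi>t (t, x))"
    using lborel_pair.integral_snd[of "\<lambda>t x. \<phi>t (t, x)"] int(1) by (simp add: lborel_prod)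
  ultimately show "(LINT p:({0<..} \<times> UNIV)|lborel. \<phi>t p) = 0" using ind[of \<phi>t] K(3) by simp
qed

section \<open>Essential supports\<close>

lemma AE_zero_off_ess_support: "AE x in lborel. x \<notin> ess_support v \<longrightarrow> v x = 0"
proof -
  let ?F = "{U. open U \<and> (AE x in lborel. x \<in> U \<longrightarrow> v x = 0)}"
  \<comment> \<open>The complement of the support is a union of possibly uncountably many open sets.
    The Lindelof property leaves countably many of them, so that the exceptional null sets can be
    united.\<close>
  have "\<And>U. U \<in> ?F \<Longrightarrow> open U" by simp
  then obtain F where F: "F \<subseteq> ?F" "countable F" "\<Union>F = \<Union>?F"
    by (rule Lindelof)
  have "AE x in lborel. \<forall>U\<in>F. x \<in> U \<longrightarrow> v x = 0"
    using F(1,2) by (intro AE_ball_countable') auto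
  then show ?thesis
  proof eventually_elim
    case (elim x)
    show ?case
    proof
      assume "x \<notin> ess_support v"
      then have "x \<in> \<Union>F" unfolding F(3) ess_support_def by blast
      with elim show "v x = 0" by blast
    qed
  qed
qed

lemma ess_support_disjoint:
  "open U \<Longrightarrow> AE x in lborel. x \<in> U \<longrightarrow> v x = 0 \<Longrightarrow> x \<in> U \<Longrightarrow> x \<notin> ess_support v"
  unfolding ess_support_def by blast

lemma closed_ess_support: "closed (ess_support v)"
  unfolding ess_support_def by auto

lemma connected_of_unique_component:
  assumes "\<exists>!S. S \<in> components A"
  shows "connected A"
proof -
  obtain S where "components A = {S}" using assms by blast
  then show ?thesis using Union_components[of A] in_components_connected[of S A] by simp
qed

text \<open>The setting for a representative that is measurable on the whole plane and bounded
  everywhere. Minimality of \<open>f\<close> at 0 takes the form \<open>0 \<le> f y\<close> because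
  \<open>f 0 = 0\<close>.\<close>

locale bounded_entropy_solution =
  fixes f :: "real \<Rightarrow> real" and v :: "real \<Rightarrow> real \<Rightarrow> real" and B :: real
  assumes convex: "convex_on UNIV f" and f_0 [simp]: "f 0 = 0" and f_nonneg: "0 \<le> f y"
    and B_pos: "0 < B" and bounded: "\<bar>v t x\<bar> \<le> B"
    and measurable_v [measurable]: "(\<lambda>p. v (fst p) (snd p)) \<in> borel_measurable borel"
    and L1_continuous: "0 \<le> t \<Longrightarrow>
      ((\<lambda>s. LINT x:{-r..r}|lborel. \<bar>v s x - v t x\<bar>) \<longlongrightarrow> 0) (at t within {0..})"
    and kruzhkov: "test_function \<phi> \<phi>t \<phi>x \<Longrightarrow>
      0 \<le> (LINT p:({0<..} \<times> UNIV)|lborel. \<bar>v (fst p) (snd p) - k\<bar> * \<phi>t p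
             + sgn (v (fst p) (snd p) - k) * (f (v (fst p) (snd p)) - f k) * \<phi>x p)"
begin

section \<open>The largest speed and the entropy pairs of a solution\<close>

lemma measurable_f [measurable]: "f \<in> borel_measurable borel"
  by (intro borel_measurable_continuous_onI convex_on_continuous convex) auto

lemma measurable_slice [measurable]: "v t \<in> borel_measurable borel"
proof -
  have "(\<lambda>x. (t, x)) \<in> borel \<rightarrow>\<^sub>M borel"
    by (intro borel_measurable_continuous_onI continuous_intros)
  from measurable_compose[OF this measurable_v] show ?thesis by simp
qed

lemma f_scale: "0 \<le> \<theta> \<Longrightarrow> \<theta> \<le> 1 \<Longrightarrow> f (\<theta> * y) \<le> \<theta> * f y"
  using convex_onD[OF convex, of \<theta> 0 y] by simp

text \<open>By convexity and f 0 = 0, f y / |y| for 0 < |y| <= B is at most f B / B or f (- B) / B,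
  depending on the sign of y. Adding the two nonnegative end values gives one bound for both
  signs.\<close>

definition max_speed :: real where "max_speed = (f B + f (- B)) / B"

lemma max_speed_nonneg: "0 \<le> max_speed"
  using B_pos f_nonneg by (simp add: max_speed_def add_nonneg_nonneg)

lemma f_le_max_speed:
  assumes "\<bar>y\<bar> \<le> B"
  shows "f y \<le> max_speed * \<bar>y\<bar>"
proof -
  have "f y \<le> (\<bar>y\<bar> / B) * (f B + f (- B))"
  proof (cases "0 \<le> y")
    case True
    then have "f y \<le> (\<bar>y\<bar> / B) * f B"
      using f_scale[of "\<bar>y\<bar> / B" B] assms B_pos by (simp add: divide_simps)
    also have "\<dots> \<le> (\<bar>y\<bar> / B) * (f B + f (- B))"
      using B_pos f_nonneg by (intro mult_left_mono) auto
    finally show ?thesis .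
  next
    case False
    then have "f y \<le> (\<bar>y\<bar> / B) * f (- B)"
      using f_scale[of "\<bar>y\<bar> / B" "- B"] assms B_pos by (simp add: divide_simps)
    also have "\<dots> \<le> (\<bar>y\<bar> / B) * (f B + f (- B))"
      using B_pos f_nonneg by (intro mult_left_mono) auto
    finally show ?thesis .
  qed
  then show ?thesis by (simp add: max_speed_def mult.commute)
qed

lemma f_bounded: "f (v t x) \<le> max_speed * B"
  using f_le_max_speed[OF bounded, of t x] mult_left_mono[OF bounded max_speed_nonneg, of t x]
  by linarith

text \<open>Applied to the 1-Lipschitz functions |y - k| and max 0 (k - y), this passes the time
  continuity of \<open>v\<close> on to its entropies.\<close>

lemma L1_continuous_nonexpansive:
  assumes "0 \<le> t" and ne: "\<And>y z. \<bar>g y - g z\<bar> \<le> \<bar>y - z\<bar>" and [measurable]: "g \<in> borel_measurable borel"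
  shows "((\<lambda>s. LINT x:{-r..r}|lborel. \<bar>g (v s x) - g (v t x)\<bar>) \<longlongrightarrow> 0) (at t within {0..})"
proof (rule Lim_null_comparison[OF _ L1_continuous[OF \<open>0 \<le> t\<close>]])
  show "\<forall>\<^sub>F s in at t within {0..}. norm (LINT x:{-r..r}|lborel. \<bar>g (v s x) - g (v t x)\<bar>)
      \<le> (LINT x:{-r..r}|lborel. \<bar>v s x - v t x\<bar>)"
  proof (intro always_eventually allI)
    fix s
    have le: "\<bar>v s x - v t x\<bar> \<le> 2 * B" for x
      using bounded[of s x] bounded[of t x] by linarith
    have i: "integrable lborel (\<lambda>x. indicator {-r..r} x *\<^sub>R \<bar>h x\<bar>)"
      if "\<And>x. \<bar>h x\<bar> \<le> \<bar>v s x - v t x\<bar>" and [measurable]: "h \<in> borel_measurable borel" for h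
    proof (rule integrable_bounded_vanishing[where K="{-r..r}" and c="2 * B"])
      show "\<bar>indicator {-r..r} x *\<^sub>R \<bar>h x\<bar>\<bar> \<le> 2 * B" for x
        using order_trans[OF that(1) le, of x] B_pos by (auto simp: indicator_def)
    qed auto
    show "norm (LINT x:{-r..r}|lborel. \<bar>g (v s x) - g (v t x)\<bar>) \<le> (LINT x:{-r..r}|lborel. \<bar>v s x - v t x\<bar>)"
      unfolding set_lebesgue_integral_def
      by (rule order_trans[OF integral_norm_bound], rule integral_mono)
         (use i[of "\<lambda>x. g (v s x) - g (v t x)"] i[of "\<lambda>x. v s x - v t x"] ne in
           \<open>auto simp: abs_mult intro!: mult_left_mono\<close>)
  qed
qed

lemma entropy_pair_kruzhkov:
  "\<exists>C. entropy_pair (\<lambda>t x. \<bar>v t x - k\<bar>) (\<lambda>t x. sgn (v t x - k) * (f (v t x) - f k)) C"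
proof (intro exI)
  let ?C = "B + \<bar>k\<bar> + (max_speed * B + f k)"
  have MB: "0 \<le> max_speed * B" using max_speed_nonneg B_pos by simp
  show "entropy_pair (\<lambda>t x. \<bar>v t x - k\<bar>) (\<lambda>t x. sgn (v t x - k) * (f (v t x) - f k)) ?C"
  proof
    show "\<bar>\<bar>v t x - k\<bar>\<bar> \<le> ?C" for t x
      using bounded[of t x] MB f_nonneg[of k] by linarith
    show "\<bar>sgn (v t x - k) * (f (v t x) - f k)\<bar> \<le> ?C" for t x
    proof -
      have "\<bar>f (v t x) - f k\<bar> \<le> max_speed * B + f k"
        using f_bounded[of t x] f_nonneg[of k] f_nonneg[of "v t x"] by linarith
      then show ?thesis using B_pos MB f_nonneg[of k] by (auto simp: abs_mult abs_sgn_eq)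
    qed
    show "((\<lambda>s. LINT x:{-r..r}|lborel. \<bar>\<bar>v s x - k\<bar> - \<bar>v t x - k\<bar>\<bar>) \<longlongrightarrow> 0) (at t within {0..})"
      if "0 \<le> t" for t r
      using L1_continuous_nonexpansive[OF that, of "\<lambda>y. \<bar>y - k\<bar>" r] by simp
  qed (use kruzhkov in \<open>auto simp: mult.assoc\<close>)
qed

text \<open>The function \<open>(k - v)\<^sub>+\<close> is the average of the Kruzhkov entropies for the constants \<open>k\<close> and
  \<open>B + 1\<close>, the latter being affine on the range of \<open>v\<close>, up to an additive constant.\<close>

lemma entropy_pair_lower:
  "\<exists>C. entropy_pair (\<lambda>t x. max 0 (k - v t x)) (\<lambda>t x. if v t x < k then f k - f (v t x) else 0) C"
proof (intro exI)
  let ?C = "B + \<bar>k\<bar> + (max_speed * B + f k)"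
  have MB: "0 \<le> max_speed * B" using max_speed_nonneg B_pos by simp
  show "entropy_pair (\<lambda>t x. max 0 (k - v t x)) (\<lambda>t x. if v t x < k then f k - f (v t x) else 0) ?C"
  proof
    show "\<bar>max 0 (k - v t x)\<bar> \<le> ?C" for t x
      using bounded[of t x] MB f_nonneg[of k] by linarith
    show "\<bar>if v t x < k then f k - f (v t x) else 0\<bar> \<le> ?C" for t x
      using f_bounded[of t x] f_nonneg[of k] f_nonneg[of "v t x"] B_pos MB by auto
    show "((\<lambda>s. LINT x:{-r..r}|lborel. \<bar>max 0 (k - v s x) - max 0 (k - v t x)\<bar>) \<longlongrightarrow> 0) (at t within {0..})"
      if "0 \<le> t" for t r
      using L1_continuous_nonexpansive[OF that, of "\<lambda>y. max 0 (k - y)" r] by simp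
    fix \<phi> \<phi>t \<phi>x assume test: "test_function \<phi> \<phi>t \<phi>x"
    obtain K where K: "compact K" "K \<subseteq> {0<..} \<times> UNIV" "\<And>p. p \<notin> K \<Longrightarrow> \<phi> p = 0 \<and> \<phi>t p = 0 \<and> \<phi>x p = 0"
      using test_function_derivatives[OF test] by blast
    have c: "continuous_on UNIV \<phi>t" "continuous_on UNIV \<phi>x"
      using test unfolding test_function_def by blast+
    let ?P = "\<lambda>k p. \<bar>v (fst p) (snd p) - k\<bar> * \<phi>t p
             + sgn (v (fst p) (snd p) - k) * (f (v (fst p) (snd p)) - f k) * \<phi>x p"
    have i: "set_integrable lborel ({0<..} \<times> UNIV) (\<lambda>p. m p * w p)"
      if "m \<in> borel_measurable borel" "\<And>p. \<bar>m p\<bar> \<le> D" "continuous_on UNIV w" "\<And>p. p \<notin> K \<Longrightarrow> w p = 0"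
      for m w :: "real \<times> real \<Rightarrow> real" and D
    proof -
      have "{0<..} \<times> UNIV \<in> sets (borel :: (real \<times> real) measure)"
        by (intro borel_open open_Times) auto
      then show ?thesis
        unfolding set_integrable_def
        using integrable_bounded_times_continuous[OF that(1-3) K(1) that(4)]
        by (intro integrable_mult_indicator) auto
    qed
    have iP: "set_integrable lborel ({0<..} \<times> UNIV) (?P k)" for k
    proof -
      obtain C where "entropy_pair (\<lambda>t x. \<bar>v t x - k\<bar>) (\<lambda>t x. sgn (v t x - k) * (f (v t x) - f k)) C"
        using entropy_pair_kruzhkov by blast
      then interpret E: entropy_pair "\<lambda>t x. \<bar>v t x - k\<bar>" "\<lambda>t x. sgn (v t x - k) * (f (v t x) - f k)" C .
      show ?thesis
        using E.measurable_\<eta> E.measurable_q E.bounded_\<eta> E.bounded_q K(3) c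
        by (intro set_integral_add(1) i[where D=C]) auto
    qed
    have ic: "set_integrable lborel ({0<..} \<times> UNIV) (\<lambda>p. a * \<phi>t p)"
             "set_integrable lborel ({0<..} \<times> UNIV) (\<lambda>p. a * \<phi>x p)" for a
      using K(3) c by (auto intro!: i[where D="\<bar>a\<bar>"])
    \<comment> \<open>All values of \<open>v\<close> lie below \<open>?k\<close>, so its Kruzhkov
      entropy is ?k - v with flux f ?k - f v. The last two integrals below are 0; they supply the
      constants that make the four integrands add up to twice the wanted one.\<close>
    let ?k = "B + 1"
    have "0 \<le> ((LINT p:({0<..} \<times> UNIV)|lborel. ?P k p) + (LINT p:({0<..} \<times> UNIV)|lborel. ?P ?k p)
        + (LINT p:({0<..} \<times> UNIV)|lborel. (k - ?k) * \<phi>t p)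
        + (LINT p:({0<..} \<times> UNIV)|lborel. (f k - f ?k) * \<phi>x p)) / 2"
      using kruzhkov[OF test, of k] kruzhkov[OF test, of ?k]
      by (simp add: test_function_integrals[OF test])
    also have "\<dots> = (LINT p:({0<..} \<times> UNIV)|lborel.
        (?P k p + ?P ?k p + (k - ?k) * \<phi>t p + (f k - f ?k) * \<phi>x p) / 2)"
      using iP[of k] iP[of ?k] ic[of "k - ?k"] ic[of "f k - f ?k"]
      by (simp add: set_integral_add)
    also have "\<dots> = (LINT p:({0<..} \<times> UNIV)|lborel. max 0 (k - v (fst p) (snd p)) * \<phi>t p
        + (if v (fst p) (snd p) < k then f k - f (v (fst p) (snd p)) else 0) * \<phi>x p)"
    proof -
      have "(?P k p + ?P ?k p + (k - ?k) * \<phi>t p + (f k - f ?k) * \<phi>x p) / 2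
          = max 0 (k - v (fst p) (snd p)) * \<phi>t p
        + (if v (fst p) (snd p) < k then f k - f (v (fst p) (snd p)) else 0) * \<phi>x p" for p
      proof -
        have "v (fst p) (snd p) < ?k" using bounded[of "fst p" "snd p"] by linarith
        then show ?thesis
          by (cases "v (fst p) (snd p)" k rule: linorder_cases) (simp_all add: field_simps)
      qed
      then show ?thesis by (simp only:)
    qed
    finally show "0 \<le> (LINT p:({0<..} \<times> UNIV)|lborel. max 0 (k - v (fst p) (snd p)) * \<phi>t p
        + (if v (fst p) (snd p) < k then f k - f (v (fst p) (snd p)) else 0) * \<phi>x p)" .
  qed auto
qed

section \<open>Propagation of nonnegativity and of vacuum\<close>

lemma nonneg_preserved:
  assumes init: "AE x in lborel. 0 \<le> v 0 x" and "0 < t"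
  shows "AE x in lborel. 0 \<le> v t x"
proof -
  obtain C where "entropy_pair (\<lambda>t x. max 0 (0 - v t x)) (\<lambda>t x. if v t x < 0 then f 0 - f (v t x) else 0) C"
    using entropy_pair_lower by blast
  then interpret E: entropy_pair "\<lambda>t x. max 0 (0 - v t x)" "\<lambda>t x. if v t x < 0 then f 0 - f (v t x) else 0" C .
  let ?L = max_speed
  \<comment> \<open>The negative part of \<open>v\<close> is an entropy that is 0 initially. Both
    edges of the trapezoid close in at the largest speed, so nothing enters it; growing
    \<open>n\<close> exhausts the line.\<close>
  have "AE x in lborel. - real n + ?L * t < x \<longrightarrow> x < real n + (- ?L) * t \<longrightarrow> max 0 (0 - v t x) = 0" for n
  proof (rule E.trapezoid_vanishing[of 1 0])
    have le: "(if v \<tau> x < 0 then f 0 - f (v \<tau> x) else 0) \<le> ?L * max 0 (0 - v \<tau> x)" for \<tau> x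
    proof -
      have "0 \<le> ?L * max 0 (0 - v \<tau> x)" using max_speed_nonneg by simp
      then show ?thesis using f_nonneg[of "v \<tau> x"] by auto
    qed
    have ge: "- ?L * max 0 (0 - v \<tau> x) \<le> (if v \<tau> x < 0 then f 0 - f (v \<tau> x) else 0)" for \<tau> x
      using f_le_max_speed[OF bounded, of \<tau> x] by auto
    show "AE x in lborel. - real n + ?L * \<tau> < x \<longrightarrow> x < - real n + ?L * \<tau> + 1 \<longrightarrow> x < real n + - ?L * \<tau> \<longrightarrow>
        (if v \<tau> x < 0 then f 0 - f (v \<tau> x) else 0) \<le> ?L * max 0 (0 - v \<tau> x)" for \<tau>
      using le by simp
    show "AE x in lborel. - real n + ?L * \<tau> < x \<longrightarrow> real n + - ?L * \<tau> - 1 < x \<longrightarrow> x < real n + - ?L * \<tau> \<longrightarrow>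
        - ?L * max 0 (0 - v \<tau> x) \<le> (if v \<tau> x < 0 then f 0 - f (v \<tau> x) else 0)" for \<tau>
      using ge by simp
    show "AE x in lborel. - real n + ?L * 0 < x \<longrightarrow> x < real n + - ?L * 0 \<longrightarrow> max 0 (0 - v 0 x) = 0"
      using init by eventually_elim simp
  qed (use \<open>0 < t\<close> in auto)
  then have "AE x in lborel. \<forall>n. - real n + ?L * t < x \<longrightarrow> x < real n + (- ?L) * t \<longrightarrow> max 0 (0 - v t x) = 0"
    by (simp add: AE_all_countable)
  then show ?thesis
  proof eventually_elim
    case (elim x)
    obtain n where "\<bar>x\<bar> + ?L * t < real n" using reals_Archimedean2 by blast
    then have "- real n + ?L * t < x" "x < real n + (- ?L) * t" by auto
    with elim have "max 0 (0 - v t x) = 0" by blast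
    then show ?case by simp
  qed
qed

text \<open>By convexity f k / k is nondecreasing in k > 0, so this is the right derivative of
  \<open>f\<close> at 0, written as an infimum to avoid a limit.\<close>

definition min_speed :: real where "min_speed = (INF k\<in>{0<..}. f k / k)"

lemma min_speed_le: "0 \<le> y \<Longrightarrow> min_speed * y \<le> f y"
proof (cases "y = 0")
  case False
  assume "0 \<le> y"
  with False have "y > 0" by simp
  have "bdd_below ((\<lambda>k. f k / k) ` {0<..})"
    using f_nonneg by (intro bdd_belowI2[where m=0]) auto
  then have "min_speed \<le> f y / y"
    unfolding min_speed_def using \<open>y > 0\<close> by (intro cINF_lower) auto
  then show ?thesis using \<open>y > 0\<close> by (simp add: pos_le_divide_eq)
qed simp

lemma min_speed_approx:
  assumes "\<epsilon> > 0"
  obtains k where "0 < k" "k \<le> 1" "f k < (min_speed + \<epsilon>) * k"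
proof -
  have "\<exists>k\<in>{0<..}. f k / k < min_speed + \<epsilon>"
    unfolding min_speed_def
    using cInf_lessD[of "(\<lambda>k. f k / k) ` {0<..}" "(INF k\<in>{0<..}. f k / k) + \<epsilon>"] assms by auto
  then obtain k where k: "k > 0" "f k < (min_speed + \<epsilon>) * k"
    by (auto simp: pos_divide_less_eq)
  \<comment> \<open>Shrinking \<open>k\<close> to at most 1 keeps the slope bound by
    \<open>f_scale\<close>. The bound \<open>k \<le> 1\<close> serves in
    \<open>vacuum_backward\<close> to compare k * min 1 v with min k v.\<close>
  define \<theta> where "\<theta> = min 1 (1 / k)"
  have \<theta>: "0 < \<theta>" "\<theta> \<le> 1" "\<theta> * k \<le> 1" using k(1) by (auto simp: \<theta>_def min_def divide_simps)
  have "f (\<theta> * k) \<le> \<theta> * f k" using \<theta> by (intro f_scale) auto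
  also have "\<dots> < \<theta> * ((min_speed + \<epsilon>) * k)" using k(2) \<theta>(1) by (rule mult_strict_left_mono)
  finally show ?thesis using that[of "\<theta> * k"] \<theta> k(1) by (simp add: mult.left_commute)
qed

text \<open>In the frame moving at \<open>min_speed\<close> the flux is convex in \<open>y\<close>,
  0 at 0 and nonnegative for y >= 0, hence nondecreasing there.\<close>

lemma relative_flux_mono:
  assumes "0 \<le> y" "y \<le> k"
  shows "f y - min_speed * y \<le> f k - min_speed * k"
proof (cases "k = 0")
  case False
  with assms have "k > 0" by simp
  have "f y \<le> (y / k) * f k" using f_scale[of "y / k" k] assms \<open>k > 0\<close> by simp
  then have "f y - min_speed * y \<le> (y / k) * (f k - min_speed * k)"
    using \<open>k > 0\<close> by (simp add: algebra_simps)
  also have "\<dots> \<le> f k - min_speed * k"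
    using mult_right_mono[of "y / k" 1 "f k - min_speed * k"] min_speed_le[of k] assms \<open>k > 0\<close> by simp
  finally show ?thesis .
qed (use assms in simp)

text \<open>The entropy (k - v)_+ is maximal on the gap at time \<open>T\<close>, and its weighted
  integral can have grown since \<open>s\<close> only by the flux term. So its deficit k - (k - v)_+
  = min k v was already small at time \<open>s\<close>. Both edges of the cutoff move at
  \<open>min_speed\<close>, hence the gap keeps its width.\<close>

lemma vacuum_backward:
  assumes nonneg: "\<And>\<tau>. 0 \<le> \<tau> \<Longrightarrow> AE x in lborel. 0 \<le> v \<tau> x" and "0 \<le> s" "s < T"
    and gap: "AE x in lborel. a + min_speed * T < x \<longrightarrow> x < b + min_speed * T \<longrightarrow> v T x = 0"
  shows "AE x in lborel. a + min_speed * s < x \<longrightarrow> x < b + min_speed * s \<longrightarrow> v s x = 0"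
proof -
  define \<psi> where "\<psi> \<tau> x = smoothstep ((x - min_speed * \<tau> - a) / 1) * smoothstep ((b + min_speed * \<tau> - x) / 1)" for \<tau> x
  have \<psi>_zero: "\<psi> \<tau> x = 0" if "\<not> (a + min_speed * \<tau> < x \<and> x < b + min_speed * \<tau>)" for \<tau> x
  proof -
    have "x - min_speed * \<tau> - a \<le> 0 \<or> b + min_speed * \<tau> - x \<le> 0" using that by linarith
    then show ?thesis by (auto simp: \<psi>_def smoothstep_eq_0)
  qed
  have \<psi>_nonneg: "0 \<le> \<psi> \<tau> x" for \<tau> x by (simp add: \<psi>_def smoothstep_nonneg)
  have cont: "continuous_on UNIV (\<psi> \<tau>)" for \<tau>
    unfolding \<psi>_def by (intro continuous_intros) auto
  then have [measurable]: "\<psi> \<tau> \<in> borel_measurable borel" for \<tau>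
    by (rule borel_measurable_continuous_onI)
  have int: "integrable lborel (\<lambda>x. m x * \<psi> \<tau> x)"
    if "m \<in> borel_measurable borel" "\<And>x. \<bar>m x\<bar> \<le> D" for m D \<tau>
  proof (rule integrable_bounded_times_continuous[OF that])
    show "continuous_on UNIV (\<psi> \<tau>)" by (rule cont)
    show "\<psi> \<tau> x = 0" if "x \<notin> {a + min_speed * \<tau>..b + min_speed * \<tau>}" for x
      using that by (intro \<psi>_zero) auto
  qed (rule compact_Icc)
  \<comment> \<open>\<open>\<psi> T\<close> is \<open>\<psi> s\<close> translated by
    \<open>min_speed * (T - s)\<close>.\<close>
  have \<psi>_shift: "(LINT x|lborel. \<psi> T x) = (LINT x|lborel. \<psi> s x)"
    using lborel_integral_real_affine[of 1 "\<psi> T" "min_speed * (T - s)"]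
    by (simp add: \<psi>_def[abs_def] algebra_simps)
  have int_min: "integrable lborel (\<lambda>x. min 1 (v s x) * \<psi> s x)"
  proof (rule int[where D="1 + B"])
    show "\<bar>min 1 (v s x)\<bar> \<le> 1 + B" for x
      using bounded[of s x] B_pos by (auto simp: min_def)
  qed simp
  let ?I = "LINT x|lborel. min 1 (v s x) * \<psi> s x"
  \<comment> \<open>\<open>min 1 (v s x)\<close> does not depend on \<open>k\<close>, and k * min 1
    v <= min k v for 0 < k <= 1 and v >= 0. So one fixed integral is estimated for all such
    \<open>k\<close>.\<close>
  have key: "k * ?I \<le> (f k - min_speed * k) * (T - s)" if k: "0 < k" "k \<le> 1" for k
  proof -
    obtain C where "entropy_pair (\<lambda>t x. max 0 (k - v t x)) (\<lambda>t x. if v t x < k then f k - f (v t x) else 0) C"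
      using entropy_pair_lower by blast
    then interpret E: entropy_pair "\<lambda>t x. max 0 (k - v t x)" "\<lambda>t x. if v t x < k then f k - f (v t x) else 0" C .
    have e: "0 \<le> f k - min_speed * k" using min_speed_le[of k] k by simp
    have "(LINT x|lborel. max 0 (k - v T x) * \<psi> T x)
        \<le> (LINT x|lborel. max 0 (k - v s x) * \<psi> s x) + (f k - min_speed * k) * (T - s)"
    proof (rule E.trapezoid_bound[of \<psi> min_speed a 1 b min_speed])
      show "\<psi> = (\<lambda>\<tau> x. smoothstep ((x - min_speed * \<tau> - a) / 1) * smoothstep ((b + min_speed * \<tau> - x) / 1))"
        by (simp add: \<psi>_def fun_eq_iff)
      \<comment> \<open>With c = \<open>min_speed\<close> and v < k, the relative flux is (f k - c
        k) - (f v - c v). It is at most f k - c k by \<open>min_speed_le\<close>, which serves the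
        left edge, and nonnegative by \<open>relative_flux_mono\<close>, which serves the right
        edge. For v >= k both entropy and flux are 0.\<close>
      fix \<tau> assume "s < \<tau>"
      then have v: "AE x in lborel. 0 \<le> v \<tau> x" using nonneg[of \<tau>] \<open>0 \<le> s\<close> by simp
      show "AE x in lborel. a + min_speed * \<tau> < x \<longrightarrow> x < a + min_speed * \<tau> + 1 \<longrightarrow> x < b + min_speed * \<tau> \<longrightarrow>
          (if v \<tau> x < k then f k - f (v \<tau> x) else 0) - min_speed * max 0 (k - v \<tau> x) \<le> f k - min_speed * k"
        using v
      proof eventually_elim
        case (elim x)
        then show ?case using e min_speed_le[of "v \<tau> x"] by (auto simp: max_def algebra_simps)
      qed
      show "AE x in lborel. a + min_speed * \<tau> < x \<longrightarrow> b + min_speed * \<tau> - 1 < x \<longrightarrow> x < b + min_speed * \<tau> \<longrightarrow>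
          0 \<le> (if v \<tau> x < k then f k - f (v \<tau> x) else 0) - min_speed * max 0 (k - v \<tau> x)"
        using v
      proof eventually_elim
        case (elim x)
        then show ?case using relative_flux_mono[of "v \<tau> x" k] by (auto simp: max_def algebra_simps)
      qed
    qed (use \<open>0 \<le> s\<close> \<open>s < T\<close> e in auto)
    also have "(LINT x|lborel. max 0 (k - v T x) * \<psi> T x) = (LINT x|lborel. k * \<psi> T x)"
    proof (rule integral_cong_AE)
      show "AE x in lborel. max 0 (k - v T x) * \<psi> T x = k * \<psi> T x"
        using gap
      proof eventually_elim
        case (elim x)
        then show ?case using \<psi>_zero[of T x] k by auto
      qed
    qed auto
    also have "\<dots> = (LINT x|lborel. k * \<psi> s x)" using \<psi>_shift by simp
    finally have le: "(LINT x|lborel. k * \<psi> s x) - (LINT x|lborel. max 0 (k - v s x) * \<psi> s x)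
        \<le> (f k - min_speed * k) * (T - s)" by simp
    have i1: "integrable lborel (\<lambda>x. k * \<psi> s x)" by (rule int[where D="k"]) (use k in auto)
    have i2: "integrable lborel (\<lambda>x. max 0 (k - v s x) * \<psi> s x)"
      by (rule int[OF _ E.bounded_\<eta>]) auto
    have "k * ?I = (LINT x|lborel. k * (min 1 (v s x) * \<psi> s x))" by simp
    also have "\<dots> \<le> (LINT x|lborel. k * \<psi> s x - max 0 (k - v s x) * \<psi> s x)"
    proof (rule integral_mono_AE)
      show "AE x in lborel. k * (min 1 (v s x) * \<psi> s x) \<le> k * \<psi> s x - max 0 (k - v s x) * \<psi> s x"
        using nonneg[OF \<open>0 \<le> s\<close>]
      proof eventually_elim
        case (elim x)
        have "k * min 1 (v s x) \<le> k - max 0 (k - v s x)"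
          using elim k mult_right_mono[of k 1 "v s x"] mult_left_mono[of "min 1 (v s x)" 1 k]
            mult_left_mono[of "min 1 (v s x)" "v s x" k]
          by (auto simp: max_def)
        from mult_right_mono[OF this \<psi>_nonneg[of s x]] show ?case by (simp add: algebra_simps)
      qed
    qed (use i1 i2 int_min in auto)
    also have "\<dots> = (LINT x|lborel. k * \<psi> s x) - (LINT x|lborel. max 0 (k - v s x) * \<psi> s x)"
      using i1 i2 by simp
    finally show ?thesis using le by linarith
  qed
  \<comment> \<open>For a suitable \<open>k\<close> the excess f k - min_speed * k is below
    \<epsilon> * k, so the factor \<open>k\<close> cancels from \<open>key\<close>.\<close>
  have "?I \<le> \<epsilon> * (T - s)" if "\<epsilon> > 0" for \<epsilon>
  proof -
    obtain k where k: "0 < k" "k \<le> 1" "f k < (min_speed + \<epsilon>) * k"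
      using min_speed_approx[OF \<open>\<epsilon> > 0\<close>] .
    have "k * ?I \<le> (f k - min_speed * k) * (T - s)" using key k by simp
    also have "\<dots> \<le> (\<epsilon> * k) * (T - s)"
      using k(3) \<open>s < T\<close> by (intro mult_right_mono) (auto simp: algebra_simps)
    finally have "k * ?I \<le> k * (\<epsilon> * (T - s))" by (simp add: algebra_simps)
    then show ?thesis using k(1) by simp
  qed
  then have "?I \<le> 0 + \<epsilon>" if "\<epsilon> > 0" for \<epsilon>
    using that \<open>s < T\<close> by (auto dest: meta_spec[of _ "\<epsilon> / (T - s)"])
  then have "?I \<le> 0" by (rule field_le_epsilon)
  moreover have nn: "AE x in lborel. 0 \<le> min 1 (v s x) * \<psi> s x"
    using nonneg[OF \<open>0 \<le> s\<close>] by eventually_elim (simp add: \<psi>_nonneg)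
  ultimately have "?I = 0"
    using integral_nonneg_AE[OF nn] by linarith
  then have "AE x in lborel. min 1 (v s x) * \<psi> s x = 0"
    using integral_nonneg_eq_0_iff_AE[OF int_min nn] by simp
  then show ?thesis
  proof eventually_elim
    case (elim x)
    show ?case
    proof (intro impI)
      assume "a + min_speed * s < x" "x < b + min_speed * s"
      then have "0 < \<psi> s x" unfolding \<psi>_def by (intro mult_pos_pos smoothstep_pos) auto
      with elim show "v s x = 0" by (auto simp: min_def split: if_splits)
    qed
  qed
qed

text \<open>Since f v >= min_speed * v, mass crosses an edge moving at \<open>min_speed\<close> only
  from left to right, so none enters the region on its left. The other edge moves right at
  \<open>max_speed\<close>, which no mass overtakes, and it is sent to minus infinity by growing
  \<open>n\<close>.\<close>

lemma left_vacuum_forward: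
  assumes nonneg: "\<And>\<tau>. 0 \<le> \<tau> \<Longrightarrow> AE x in lborel. 0 \<le> v \<tau> x" and "0 < t"
    and init: "AE x in lborel. x < b \<longrightarrow> v 0 x = 0"
  shows "AE x in lborel. x < b + min_speed * t \<longrightarrow> v t x = 0"
proof -
  obtain C where "entropy_pair (\<lambda>t x. \<bar>v t x - 0\<bar>) (\<lambda>t x. sgn (v t x - 0) * (f (v t x) - f 0)) C"
    using entropy_pair_kruzhkov by blast
  then interpret E: entropy_pair "\<lambda>t x. \<bar>v t x - 0\<bar>" "\<lambda>t x. sgn (v t x - 0) * (f (v t x) - f 0)" C .
  have "AE x in lborel. - real n + max_speed * t < x \<longrightarrow> x < b + min_speed * t \<longrightarrow> \<bar>v t x - 0\<bar> = 0" for n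
  proof (rule E.trapezoid_vanishing[of 1 0])
    fix \<tau> :: real assume "0 < \<tau>"
    then have v: "AE x in lborel. 0 \<le> v \<tau> x" using nonneg[of \<tau>] by simp
    show "AE x in lborel. - real n + max_speed * \<tau> < x \<longrightarrow> x < - real n + max_speed * \<tau> + 1 \<longrightarrow>
        x < b + min_speed * \<tau> \<longrightarrow> sgn (v \<tau> x - 0) * (f (v \<tau> x) - f 0) \<le> max_speed * \<bar>v \<tau> x - 0\<bar>"
      using v
    proof eventually_elim
      case (elim x)
      then show ?case using f_le_max_speed[OF bounded, of \<tau> x] by (auto simp: sgn_if)
    qed
    show "AE x in lborel. - real n + max_speed * \<tau> < x \<longrightarrow> b + min_speed * \<tau> - 1 < x \<longrightarrow>
        x < b + min_speed * \<tau> \<longrightarrow> min_speed * \<bar>v \<tau> x - 0\<bar> \<le> sgn (v \<tau> x - 0) * (f (v \<tau> x) - f 0)"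
      using v
    proof eventually_elim
      case (elim x)
      then show ?case using min_speed_le[of "v \<tau> x"] by (auto simp: sgn_if)
    qed
  next
    show "AE x in lborel. - real n + max_speed * 0 < x \<longrightarrow> x < b + min_speed * 0 \<longrightarrow> \<bar>v 0 x - 0\<bar> = 0"
      using init by eventually_elim simp
  qed (use \<open>0 < t\<close> in auto)
  then have "AE x in lborel. \<forall>n. - real n + max_speed * t < x \<longrightarrow> x < b + min_speed * t \<longrightarrow> \<bar>v t x - 0\<bar> = 0"
    unfolding AE_all_countable by (rule allI)
  then show ?thesis
  proof eventually_elim
    case (elim x)
    obtain n where "max_speed * t - x < real n" using reals_Archimedean2 by blast
    then have "- real n + max_speed * t < x" by auto
    with elim show ?case by auto
  qed
qed

text \<open>Ramp width b - a places the whole left ramp inside the gap, where entropy and flux are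
  0, so nothing enters from the left. A nonnegative solution has nonnegative flux and the right edge
  does not move to the right, so nothing enters there either; growing \<open>n\<close> sends that
  edge to infinity.\<close>

lemma right_vacuum_forward:
  assumes nonneg: "\<And>\<tau>. 0 \<le> \<tau> \<Longrightarrow> AE x in lborel. 0 \<le> v \<tau> x" and "0 < t" and "a < b"
    and gap: "\<And>\<tau>. 0 < \<tau> \<Longrightarrow> \<tau> < t \<Longrightarrow>
      AE x in lborel. a + min_speed * \<tau> < x \<longrightarrow> x < b + min_speed * \<tau> \<longrightarrow> v \<tau> x = 0"
    and init: "AE x in lborel. a < x \<longrightarrow> v 0 x = 0"
  shows "AE x in lborel. a + min_speed * t < x \<longrightarrow> v t x = 0"
proof -
  obtain C where "entropy_pair (\<lambda>t x. \<bar>v t x - 0\<bar>) (\<lambda>t x. sgn (v t x - 0) * (f (v t x) - f 0)) C"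
    using entropy_pair_kruzhkov by blast
  then interpret E: entropy_pair "\<lambda>t x. \<bar>v t x - 0\<bar>" "\<lambda>t x. sgn (v t x - 0) * (f (v t x) - f 0)" C .
  have "AE x in lborel. a + min_speed * t < x \<longrightarrow> x < real n + (- max_speed) * t \<longrightarrow> \<bar>v t x - 0\<bar> = 0" for n
  proof (rule E.trapezoid_vanishing[of "b - a" 0])
    fix \<tau> :: real assume \<tau>: "0 < \<tau>" "\<tau> < t"
    then have v: "AE x in lborel. 0 \<le> v \<tau> x" using nonneg[of \<tau>] by simp
    show "AE x in lborel. a + min_speed * \<tau> < x \<longrightarrow> x < a + min_speed * \<tau> + (b - a) \<longrightarrow>
        x < real n + - max_speed * \<tau> \<longrightarrow> sgn (v \<tau> x - 0) * (f (v \<tau> x) - f 0) \<le> min_speed * \<bar>v \<tau> x - 0\<bar>"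
      using gap[OF \<tau>] by eventually_elim auto
    show "AE x in lborel. a + min_speed * \<tau> < x \<longrightarrow> real n + - max_speed * \<tau> - (b - a) < x \<longrightarrow>
        x < real n + - max_speed * \<tau> \<longrightarrow> - max_speed * \<bar>v \<tau> x - 0\<bar> \<le> sgn (v \<tau> x - 0) * (f (v \<tau> x) - f 0)"
      using v
    proof eventually_elim
      case (elim x)
      have "0 \<le> max_speed * \<bar>v \<tau> x\<bar>" using max_speed_nonneg by simp
      moreover have "0 \<le> sgn (v \<tau> x) * f (v \<tau> x)" using elim f_nonneg by (simp add: sgn_if)
      ultimately show ?case by simp
    qed
  next
    show "AE x in lborel. a + min_speed * 0 < x \<longrightarrow> x < real n + - max_speed * 0 \<longrightarrow> \<bar>v 0 x - 0\<bar> = 0"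
      using init by eventually_elim simp
  qed (use \<open>0 < t\<close> \<open>a < b\<close> in auto)
  then have "AE x in lborel. \<forall>n. a + min_speed * t < x \<longrightarrow> x < real n + (- max_speed) * t \<longrightarrow> \<bar>v t x - 0\<bar> = 0"
    unfolding AE_all_countable by (rule allI)
  then show ?thesis
  proof eventually_elim
    case (elim x)
    obtain n where "x + max_speed * t < real n" using reals_Archimedean2 by blast
    then have "x < real n + (- max_speed) * t" by auto
    with elim show ?case by auto
  qed
qed

lemma connected_support_preserved:
  assumes init_nonneg: "AE x in lborel. 0 \<le> v 0 x" and conn: "connected (ess_support (v 0))" and "0 < t"
  shows "connected (ess_support (v t))"
proof (rule ccontr)
  assume "\<not> connected (ess_support (v t))"
  then obtain x y z where xy: "x \<in> ess_support (v t)" "y \<in> ess_support (v t)"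
    and z: "x < z" "z < y" "z \<notin> ess_support (v t)"
    unfolding connected_iff_interval by (metis order_le_less)
  have nonneg: "AE x in lborel. 0 \<le> v \<tau> x" if "0 \<le> \<tau>" for \<tau>
    using nonneg_preserved[OF init_nonneg, of \<tau>] init_nonneg that by (cases "\<tau> = 0") auto
  obtain e where e: "e > 0" "ball z e \<subseteq> - ess_support (v t)"
    using openE[of "- ess_support (v t)" z] z(3) closed_ess_support[of "v t"] by (auto simp: open_Compl)
  \<comment> \<open>The ball around \<open>z\<close> is carried back from time \<open>t\<close> to
    time 0 at \<open>min_speed\<close>.\<close>
  define a where "a = z - e - min_speed * t"
  define b where "b = z + e - min_speed * t"
  have "a < b" using e(1) by (simp add: a_def b_def)
  have xa: "x \<le> a + min_speed * t" and yb: "b + min_speed * t \<le> y"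
  proof -
    have "x \<notin> ball z e" "y \<notin> ball z e" using e(2) xy by blast+
    then show "x \<le> a + min_speed * t" "b + min_speed * t \<le> y"
      using z by (auto simp: a_def b_def dist_real_def)
  qed
  have "AE x in lborel. a + min_speed * t < x \<longrightarrow> x < b + min_speed * t \<longrightarrow> v t x = 0"
    using AE_zero_off_ess_support[of "v t"]
  proof eventually_elim
    case (elim \<xi>)
    have "\<xi> \<in> ball z e" if "a + min_speed * t < \<xi>" "\<xi> < b + min_speed * t"
      using that by (auto simp: a_def b_def dist_real_def)
    with elim e(2) show ?case by blast
  qed
  then have gap: "AE x in lborel. a + min_speed * \<tau> < x \<longrightarrow> x < b + min_speed * \<tau> \<longrightarrow> v \<tau> x = 0"
    if "0 \<le> \<tau>" "\<tau> < t" for \<tau>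
    using vacuum_backward[OF nonneg that] by blast
  have off0: "\<xi> \<notin> ess_support (v 0)" if "a < \<xi>" "\<xi> < b" for \<xi>
    by (rule ess_support_disjoint[of "{a<..<b}"]) (use gap[of 0] \<open>0 < t\<close> that in auto)
  \<comment> \<open>Points of the initial support on both sides of the gap would, by connectedness,
    put the midpoint of the gap into the support.\<close>
  have "(\<forall>\<xi>\<in>ess_support (v 0). b \<le> \<xi>) \<or> (\<forall>\<xi>\<in>ess_support (v 0). \<xi> \<le> a)"
  proof (rule ccontr)
    assume "\<not> ?thesis"
    then obtain \<xi> \<zeta> where *: "\<xi> \<in> ess_support (v 0)" "\<not> b \<le> \<xi>" "\<zeta> \<in> ess_support (v 0)" "\<not> \<zeta> \<le> a"
      by blast
    have "\<xi> \<le> a" "b \<le> \<zeta>" using off0[of \<xi>] off0[of \<zeta>] * by force+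
    then have "(a + b) / 2 \<in> {\<xi>..\<zeta>}" using \<open>a < b\<close> by auto
    then have "(a + b) / 2 \<in> ess_support (v 0)"
      using connected_contains_Icc[OF conn *(1,3)] by blast
    then show False using off0[of "(a + b) / 2"] \<open>a < b\<close> by simp
  qed
  then show False
  proof
    assume 1: "\<forall>\<xi>\<in>ess_support (v 0). b \<le> \<xi>"
    have "AE x in lborel. x < b \<longrightarrow> v 0 x = 0"
      using AE_zero_off_ess_support[of "v 0"] by eventually_elim (use 1 in force)
    from left_vacuum_forward[OF nonneg \<open>0 < t\<close> this]
    have "x \<notin> ess_support (v t)"
      by (intro ess_support_disjoint[of "{..<b + min_speed * t}"]) (use xa \<open>a < b\<close> in auto)
    then show False using xy by simp
  next
    assume 2: "\<forall>\<xi>\<in>ess_support (v 0). \<xi> \<le> a"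
    have "AE x in lborel. a < x \<longrightarrow> v 0 x = 0"
      using AE_zero_off_ess_support[of "v 0"] by eventually_elim (use 2 in force)
    from right_vacuum_forward[OF nonneg \<open>0 < t\<close> \<open>a < b\<close> gap this]
    have "y \<notin> ess_support (v t)"
      by (intro ess_support_disjoint[of "{a + min_speed * t<..}"]) (use yb \<open>a < b\<close> in auto)
    then show False using xy by simp
  qed
qed

end

section \<open>Bounded representatives and the conclusion\<close>

lemma ess_support_cong_AE:
  assumes "AE x in lborel. v x = w x"
  shows "ess_support v = ess_support w"
proof -
  have "(AE x in lborel. x \<in> U \<longrightarrow> v x = 0) \<longleftrightarrow> (AE x in lborel. x \<in> U \<longrightarrow> w x = 0)" for U
    by (rule eventually_cong[OF assms]) simp
  then show ?thesis unfolding ess_support_def by simp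
qed

text \<open>Truncation to [-B, B] and extension by 0 to t < 0 change \<open>u t\<close> only on a
  null set for each t >= 0. The L1 distances and the entropy integrals do not see such
  changes.\<close>

lemma entropy_solution_representative:
  assumes convex: "convex_on UNIV f" and f0: "f 0 = 0" and fmin: "\<forall>y. f 0 \<le> f y"
    and sol: "entropy_solution f u0 u"
  obtains v B where "bounded_entropy_solution f v B" "\<And>t. 0 \<le> t \<Longrightarrow> AE x in lborel. v t x = u t x"
proof -
  from sol obtain B0 where B0: "\<And>t. 0 \<le> t \<Longrightarrow> AE x in lborel. \<bar>u t x\<bar> \<le> B0"
    and meas: "set_borel_measurable lborel ({0..} \<times> UNIV) (\<lambda>(t, x). u t x)"
    and L1: "\<And>t r. 0 \<le> t \<Longrightarrow>
      ((\<lambda>s. LINT x:{-r..r}|lborel. \<bar>u s x - u t x\<bar>) \<longlongrightarrow> 0) (at t within {0..})"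
    and kr: "\<And>k \<phi> \<phi>t \<phi>x. test_function \<phi> \<phi>t \<phi>x \<Longrightarrow>
        0 \<le> (LINT (t, x):({0<..} \<times> UNIV)|lborel.
               \<bar>u t x - k\<bar> * \<phi>t (t, x) + sgn (u t x - k) * (f (u t x) - f k) * \<phi>x (t, x))"
    unfolding entropy_solution_def by blast
  \<comment> \<open>The added 1 makes \<open>B\<close> positive, as \<open>max_speed\<close> divides
    by it.\<close>
  define B where "B = \<bar>B0\<bar> + 1"
  define w where "w p = indicator ({0..} \<times> UNIV) p * u (fst p) (snd p)" for p :: "real \<times> real"
  define v where "v t x = max (- B) (min B (w (t, x)))" for t x
  have w [measurable]: "w \<in> borel_measurable borel"
    using meas unfolding set_borel_measurable_def w_def by (simp add: case_prod_beta)
  have mf [measurable]: "f \<in> borel_measurable borel"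
    by (intro borel_measurable_continuous_onI convex_on_continuous convex) auto
  have slice: "(\<lambda>x. w (t, x)) \<in> borel_measurable borel" for t
  proof -
    have "(\<lambda>x. (t, x)) \<in> borel \<rightarrow>\<^sub>M borel"
      by (intro borel_measurable_continuous_onI continuous_intros)
    from measurable_compose[OF this w] show ?thesis .
  qed
  have w_eq: "w (t, x) = u t x" if "0 \<le> t" for t x using that by (simp add: w_def)
  have mv [measurable]: "(\<lambda>p. v (fst p) (snd p)) \<in> borel_measurable borel"
    unfolding v_def by simp
  have ae: "AE x in lborel. v t x = u t x" if "0 \<le> t" for t
    using B0[OF that] by eventually_elim (auto simp: v_def w_eq[OF that] B_def)
  have u_slice: "u t \<in> borel_measurable borel" if "0 \<le> t" for t
    using slice[of t] w_eq[OF that] by simp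
  have v_slice: "v t \<in> borel_measurable borel" for t
    using slice[of t] unfolding v_def[abs_def] by simp
  \<comment> \<open>Joint measurability turns null sets in all time slices into a null set of the
    plane, which is what the entropy integrals require.\<close>
  have ae2: "AE p in lborel. p \<in> {0<..} \<times> UNIV \<longrightarrow> v (fst p) (snd p) = w p"
  proof -
    have "AE p in lborel \<Otimes>\<^sub>M lborel. p \<in> {0<..} \<times> UNIV \<longrightarrow> v (fst p) (snd p) = w p"
    proof (rule lborel_pair.AE_pair_measure)
      have [measurable]: "{0<..} \<times> UNIV \<in> sets (borel :: (real \<times> real) measure)"
        by (intro borel_open open_Times) auto
      have "{p \<in> space borel. p \<in> {0<..} \<times> UNIV \<longrightarrow> v (fst p) (snd p) = w p} \<in> sets borel"
        by measurable
      then show "{p \<in> space (lborel \<Otimes>\<^sub>M lborel). p \<in> {0<..} \<times> UNIV \<longrightarrow> v (fst p) (snd p) = w p}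
          \<in> sets (lborel \<Otimes>\<^sub>M lborel)"
        by (simp only: lborel_prod sets_lborel space_lborel space_borel)
      show "AE t in lborel. AE x in lborel. (t, x) \<in> {0<..} \<times> UNIV \<longrightarrow> v (fst (t, x)) (snd (t, x)) = w (t, x)"
      proof (rule AE_I2)
        fix t :: real
        show "AE x in lborel. (t, x) \<in> {0<..} \<times> UNIV \<longrightarrow> v (fst (t, x)) (snd (t, x)) = w (t, x)"
        proof (cases "0 < t")
          case True
          then show ?thesis using ae[of t] by (simp add: w_eq)
        qed simp
      qed
    qed
    then show ?thesis by (simp only: lborel_prod)
  qed
  have "bounded_entropy_solution f v B"
  proof
    show "\<bar>v t x\<bar> \<le> B" for t x by (auto simp: v_def B_def)
    show "0 \<le> f y" for y using fmin f0 by simp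
    show "0 < B" by (simp add: B_def)
    show "((\<lambda>s. LINT x:{-r..r}|lborel. \<bar>v s x - v t x\<bar>) \<longlongrightarrow> 0) (at t within {0..})" if t: "0 \<le> t" for t r
    proof (rule Lim_transform_eventually[OF L1[OF t, of r]])
      show "\<forall>\<^sub>F s in at t within {0..}.
          (LINT x:{-r..r}|lborel. \<bar>u s x - u t x\<bar>) = (LINT x:{-r..r}|lborel. \<bar>v s x - v t x\<bar>)"
        unfolding eventually_at_filter
      proof (intro always_eventually allI impI)
        fix s :: real assume "s \<in> {0..}"
        then have s: "0 \<le> s" by simp
        show "(LINT x:{-r..r}|lborel. \<bar>u s x - u t x\<bar>) = (LINT x:{-r..r}|lborel. \<bar>v s x - v t x\<bar>)"
          unfolding set_lebesgue_integral_def
        proof (rule integral_cong_AE)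
          show "AE x in lborel. indicator {-r..r} x *\<^sub>R \<bar>u s x - u t x\<bar> = indicator {-r..r} x *\<^sub>R \<bar>v s x - v t x\<bar>"
            using ae[OF s] ae[OF t] by eventually_elim simp
        qed (use u_slice[OF s] u_slice[OF t] v_slice in measurable)
      qed
    qed
    fix k \<phi> \<phi>t \<phi>x assume test: "test_function \<phi> \<phi>t \<phi>x"
    have [measurable]: "\<phi>t \<in> borel_measurable borel" "\<phi>x \<in> borel_measurable borel"
      using test unfolding test_function_def by (auto intro: borel_measurable_continuous_onI)
    have ind [measurable]: "{0<..} \<times> UNIV \<in> sets (borel :: (real \<times> real) measure)"
      by (intro borel_open open_Times) auto
    have "0 \<le> (LINT p:({0<..} \<times> UNIV)|lborel. \<bar>u (fst p) (snd p) - k\<bar> * \<phi>t p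
             + sgn (u (fst p) (snd p) - k) * (f (u (fst p) (snd p)) - f k) * \<phi>x p)"
      using kr[OF test, of k] by (simp only: case_prod_unfold prod.collapse)
    also have "\<dots> = (LINT p:({0<..} \<times> UNIV)|lborel. \<bar>w p - k\<bar> * \<phi>t p
             + sgn (w p - k) * (f (w p) - f k) * \<phi>x p)"
      unfolding set_lebesgue_integral_def
      by (intro Bochner_Integration.integral_cong refl) (auto simp: w_def indicator_def)
    also have "\<dots> = (LINT p:({0<..} \<times> UNIV)|lborel. \<bar>v (fst p) (snd p) - k\<bar> * \<phi>t p
             + sgn (v (fst p) (snd p) - k) * (f (v (fst p) (snd p)) - f k) * \<phi>x p)"
      unfolding set_lebesgue_integral_def
    proof (rule integral_cong_AE)
      show "AE p in lborel. indicator ({0<..} \<times> UNIV) p *\<^sub>R (\<bar>w p - k\<bar> * \<phi>t p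
             + sgn (w p - k) * (f (w p) - f k) * \<phi>x p)
          = indicator ({0<..} \<times> UNIV) p *\<^sub>R (\<bar>v (fst p) (snd p) - k\<bar> * \<phi>t p
             + sgn (v (fst p) (snd p) - k) * (f (v (fst p) (snd p)) - f k) * \<phi>x p)"
        using ae2 by eventually_elim (auto simp: indicator_def)
    qed (use w mv ind in measurable)
    finally show "0 \<le> (LINT p:({0<..} \<times> UNIV)|lborel. \<bar>v (fst p) (snd p) - k\<bar> * \<phi>t p
             + sgn (v (fst p) (snd p) - k) * (f (v (fst p) (snd p)) - f k) * \<phi>x p)" .
  qed (use convex f0 in auto)
  with ae show ?thesis using that by blast
qed

theorem lemma4p1:
  fixes f u0 :: "real \<Rightarrow> real" and u :: "real \<Rightarrow> real \<Rightarrow> real" and C M t :: real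
  assumes "convex_on UNIV f"
    and "f 0 = 0" and "\<forall>v. f 0 \<le> f v"
    and "u0 \<in> class_B"
    and "Linf_norm lborel u0 = ereal M"
    and "Linf_norm (restrict_space lborel {0..M}) (a_coeff f) \<le> ereal C"
    and "Lip_plus_bounded u0"
    and "\<exists>!S. S \<in> components (ess_support u0)"
    and "entropy_solution f u0 u"
    and "t > 0"
  shows "connected (ess_support (u t))"
proof -
  obtain v B where v: "bounded_entropy_solution f v B" "\<And>t. 0 \<le> t \<Longrightarrow> AE x in lborel. v t x = u t x"
    using entropy_solution_representative assms(1-3,9) by blast
  have "AE x in lborel. u 0 x = u0 x" using assms(9) unfolding entropy_solution_def by blast
  with v(2)[of 0] have v0: "AE x in lborel. v 0 x = u0 x" by (auto elim: eventually_elim2)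
  have "AE x in lborel. 0 \<le> u0 x" using assms(4) unfolding class_B_def by blast
  with v0 have "AE x in lborel. 0 \<le> v 0 x" by eventually_elim simp
  moreover have "connected (ess_support (v 0))"
    using connected_of_unique_component[OF assms(8)] ess_support_cong_AE[OF v0] by simp
  ultimately have "connected (ess_support (v t))"
    using bounded_entropy_solution.connected_support_preserved[OF v(1)] \<open>t > 0\<close> by blast
  then show ?thesis using ess_support_cong_AE[OF v(2)[of t]] \<open>t > 0\<close> by simp
qed

end
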